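(* Let $h\ge 1$ be an integer and let $X_h$ be a bouquet (wedge) of $h$ circles. Then $$ct(X_h)=\left\lceil\frac{3+\sqrt{1+8h}}{2}\right\rceil.$$ That is, $ct(X_h)$ is the unique integer $n$ such that $$\binom{n-2}{2}<h\le\binom{n-1}{2}.$$
   Context: A good (open) cover of a topological space $X$ is a family of contractible open subspaces $U_i$ covering $X$ such that every nonempty intersection $U_{i_1}\cap\dots\cap U_{i_n}$ is contractible. The strict covering type of $X$ is the minimum number of elements in a good open cover of $X$. The covering type $ct(X)$ is the minimum of the strict covering types of spaces $X'$ homotopy equivalent to $X$. Here $\binom{m}{2}=m(m-1)/2$. *)

theory Defs
  imports "HOL-Analysis.Analysis" "HOL-Library.Extended_Nat"
begin

text \<open>
  A contractible space is nonempty by convention, whereas the library predicate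
  \<open>contractible_space\<close> holds of the empty space; hence the explicit
  nonemptiness conditions.
\<close>

definition good_open_cover :: "'a topology \<Rightarrow> 'a set set \<Rightarrow> bool" where
  "good_open_cover X \<U> \<longleftrightarrow>
     (\<forall>U\<in>\<U>. openin X U \<and> U \<noteq> {} \<and> contractible_space (subtopology X U)) \<and>
     \<Union>\<U> = topspace X \<and>
     (\<forall>\<F>. finite \<F> \<and> \<F> \<noteq> {} \<and> \<F> \<subseteq> \<U> \<and> \<Inter>\<F> \<noteq> {} \<longrightarrow>
        contractible_space (subtopology X (\<Inter>\<F>)))"

text \<open>
  On \<open>enat\<close> the infimum of a nonempty set is its minimum, and the infimum of the
  empty set is \<open>\<infinity>\<close>; so \<open>\<infinity>\<close> means that there is no finite good open cover.
\<close>

definition strict_covering_type :: "'a topology \<Rightarrow> enat" where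
  "strict_covering_type X = Inf {enat (card \<U>) |\<U>. finite \<U> \<and> good_open_cover X \<U>}"

text \<open>
  A HOL definition cannot quantify over all types, so the point type \<open>'u\<close> of the
  competing spaces is a parameter, acting as a universe. It has to be large enough to
  contain the relevant spaces. For \<open>X :: 'a topology\<close> the choice \<open>'a + 'u\<close> with \<open>'u\<close>
  a free type variable contains a homeomorphic copy of \<open>X\<close> and of every space on an
  arbitrary type \<open>'u\<close>.
\<close>

definition covering_type :: "'u itself \<Rightarrow> 'a topology \<Rightarrow> enat" where
  "covering_type _ X =
     Inf {strict_covering_type Y |Y :: 'u topology. X homotopy_equivalent_space Y}"

text \<open>
  The wedge is characterised up to homeomorphism as the quotient of a disjoint union of
  \<open>h\<close> unit circles by the relation whose only nontrivial class consists of the base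
  points \<open>(i, 1)\<close>. This is meant for \<open>h \<ge> 1\<close>.
\<close>

definition bouquet_of_circles :: "nat \<Rightarrow> 'a topology \<Rightarrow> bool" where
  "bouquet_of_circles h X \<longleftrightarrow>
     (\<exists>q :: nat \<times> complex \<Rightarrow> 'a.
        quotient_map (sum_topology (\<lambda>_. top_of_set (sphere 0 1)) {..<h}) X q \<and>
        (\<forall>i<h. \<forall>j<h. \<forall>z\<in>sphere 0 1. \<forall>w\<in>sphere 0 1.
           q (i, z) = q (j, w) \<longleftrightarrow> (i, z) = (j, w) \<or> z = 1 \<and> w = 1))"

end

theory Submission
  imports Defs
begin

text \<open>
  Lower bound. Let \<open>\<U>\<close> be a good cover of \<open>Y\<close> with \<open>n\<close> members. A circle-valued map on \<open>Y\<close> has a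
  continuous square root on every member of \<open>\<U>\<close>, unique up to sign, and on every nonempty pairwise
  intersection two such roots agree or are opposite. Two maps with the same pattern of agreements have a
  quotient with a global square root. If \<open>Y\<close> is homotopy equivalent to the bouquet, then the \<open>2 ^ h\<close> maps
  which are the identity on some of the circles and constant on the others admit no such quotients, since the
  identity of the circle is not a square. Counting maps, choices of signs (up to a global sign) and patterns
  gives \<open>2 ^ h * 2 ^ (n - 1) \<le> 2 ^ (n choose 2)\<close>.

  Upper bound. For \<open>h \<le> m choose 2\<close> take the graph consisting of a star with \<open>m\<close> leaves and \<open>h\<close> further edges
  between the leaves. The open stars of its \<open>m + 1\<close> vertices form a good cover, and collapsing the
  star with \<open>m\<close> leaves is a homotopy equivalence onto the bouquet.
\<close>

subsection \<open>Square roots of circle-valued maps\<close>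

lemma continuous_map_divide_field:
  fixes f g :: "'a \<Rightarrow> 'b::real_normed_field"
  assumes "continuous_map X euclidean f" "continuous_map X euclidean g"
    and "\<And>x. x \<in> topspace X \<Longrightarrow> g x \<noteq> 0"
  shows "continuous_map X euclidean (\<lambda>x. f x / g x)"
proof -
  have "continuous_map X (top_of_set (UNIV \<times> - {0})) (\<lambda>x. (f x, g x))"
    using assms by (auto simp: continuous_map_in_subtopology continuous_map_pairwise o_def
        simp flip: euclidean_product_topology prod_topology_euclidean)
  moreover have "continuous_map (top_of_set (UNIV \<times> - {0})) euclidean (\<lambda>(x, y). x / y :: 'b)"
    by (auto intro!: continuous_intros simp: case_prod_unfold)
  ultimately have "continuous_map X euclidean ((\<lambda>(x, y). x / y) \<circ> (\<lambda>x. (f x, g x)))"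
    by (rule continuous_map_compose)
  then show ?thesis
    by (simp add: o_def)
qed

text \<open>The image is a connected subset of the finite set \<open>{1, -1}\<close>, hence a single
  point.\<close>

lemma continuous_map_sign_constant:
  fixes f :: "'a \<Rightarrow> complex"
  assumes "connected_space X" "continuous_map X euclidean f"
    and "\<And>x. x \<in> topspace X \<Longrightarrow> (f x)\<^sup>2 = 1"
    and "x \<in> topspace X" "y \<in> topspace X"
  shows "f x = f y"
proof -
  have "connected (f ` topspace X)"
    using assms(1,2) by (metis connectedin_continuous_map_image connectedin_iff_connected connectedin_topspace)
  moreover have "f ` topspace X \<subseteq> {1, -1}"
    using assms(3) by (auto simp: power2_eq_1_iff)
  then have "finite (f ` topspace X)"
    by (meson finite.emptyI finite.insertI finite_subset)
  ultimately obtain c where "f ` topspace X \<subseteq> {c}"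
    by (metis connected_finite_iff_sing empty_subsetI order_refl)
  then show ?thesis
    using assms(4,5) by blast
qed

text \<open>The path \<open>t \<mapsto> H (t, x)\<close> has a logarithm for each \<open>x\<close>
  separately, and these lifts are chosen with no coherence in \<open>x\<close>. Only the increment
  of a lift enters \<open>l\<close>, and continuity of \<open>l\<close> comes from comparing the
  lifts at nearby points by means of the principal logarithm.\<close>

lemma continuous_logarithm_nullhomotopic:
  fixes f :: "'a \<Rightarrow> complex"
  assumes hom: "homotopic_with (\<lambda>x. True) X (top_of_set (sphere 0 1)) f (\<lambda>x. c)"
  obtains l where "continuous_map X euclidean l" "\<And>x. x \<in> topspace X \<Longrightarrow> f x = exp (l x)"
proof (cases "topspace X = {}")
  case True
  then show ?thesis
    by (intro that[of "\<lambda>x. 0"]) auto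
next
  case False
  obtain H where contH: "continuous_map (prod_topology (top_of_set {0..1::real}) X) (top_of_set (sphere 0 1)) H"
    and H0: "\<And>x. H (0, x) = f x" and H1: "\<And>x. H (1, x) = c"
    using hom unfolding homotopic_with_def by auto
  have normH: "norm (H (t, x)) = 1" if "t \<in> {0..1}" "x \<in> topspace X" for t x
    using contH that by (auto simp: continuous_map_def Pi_iff)
  have contH': "continuous_map (prod_topology (top_of_set {0..1::real}) X) euclidean H"
    using contH continuous_map_into_fulltopology by blast
  have norm_c: "norm c = 1"
    using normH[of 1] H1 False by fastforce
  have path: "continuous_on {0..1} (\<lambda>t. H (t, x))" if "x \<in> topspace X" for x
  proof -
    have "continuous_map (top_of_set {0..1}) euclidean (H \<circ> (\<lambda>t. (t, x)))"
      by (rule continuous_map_compose[OF _ contH']) (use that in \<open>auto intro!: continuous_intros simp: continuous_map_pairwise o_def\<close>)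
    then show ?thesis
      by (simp add: o_def)
  qed
  have "\<exists>L. continuous_on {0..1} L \<and> (\<forall>t\<in>{0..1}. H (t, x) = exp (L t))" if "x \<in> topspace X" for x
  proof (rule continuous_logarithm_on_contractible[OF path[OF that], of thesis for thesis])
    show "contractible {0..1::real}"
      by (simp add: convex_imp_contractible)
  qed (use normH[OF _ that] in fastforce)+
  then obtain L where contL: "\<And>x. x \<in> topspace X \<Longrightarrow> continuous_on {0..1} (L x)"
    and L: "\<And>x t. \<lbrakk>x \<in> topspace X; t \<in> {0..1}\<rbrakk> \<Longrightarrow> H (t, x) = exp (L x t)"
    by metis
  \<comment> \<open>Two lifts at \<open>x\<close> differ by a constant, so
    \<open>L x 0 - L x 1\<close> is independent of the choice. Since \<open>L x 1\<close> is a
    logarithm of \<open>c\<close>, adding \<open>Ln c\<close> yields a logarithm of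
    \<open>f x\<close>.\<close>
  define l where "l x = L x 0 - L x 1 + Ln c" for x
  have exp_l: "f x = exp (l x)" if "x \<in> topspace X" for x
    using L[OF that, of 0] L[OF that, of 1] norm_c
    by (auto simp: l_def exp_add exp_diff H0 H1)
  have local: "\<exists>N. openin X N \<and> x0 \<in> N \<and> (\<forall>x\<in>N. Re (f x / f x0) > 0 \<and> l x = l x0 + Ln (f x / f x0))"
    if x0: "x0 \<in> topspace X" for x0
  proof -
    let ?W = "{p \<in> topspace (prod_topology (top_of_set {0..1::real}) X). Re (H p / H (fst p, x0)) \<in> {0<..}}"
    have "continuous_map (prod_topology (top_of_set {0..1::real}) X) euclidean ((\<lambda>t. H (t, x0)) \<circ> fst)"
      by (rule continuous_map_compose[OF continuous_map_fst]) (use path[OF x0] in auto)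
    then have "continuous_map (prod_topology (top_of_set {0..1::real}) X) euclidean (\<lambda>p. H p / H (fst p, x0))"
      using normH[OF _ x0] by (intro continuous_map_divide_field contH') (force simp: o_def)+
    then have "continuous_map (prod_topology (top_of_set {0..1::real}) X) euclidean (Re \<circ> (\<lambda>p. H p / H (fst p, x0)))"
      by (rule continuous_map_compose) (auto intro!: continuous_intros)
    then have "openin (prod_topology (top_of_set {0..1::real}) X) ?W"
      by (subst openin_continuous_map_preimage) (auto simp: o_def)
    moreover have "{0..1} \<times> {x0} \<subseteq> ?W"
      using normH[OF _ x0] x0 by (force)
    moreover have "compactin (top_of_set {0..1::real}) {0..1}"
      by (simp add: compactin_subtopology)
    \<comment> \<open>By compactness of \<open>{0..1}\<close> one neighbourhood \<open>N\<close>
      serves all \<open>t\<close>: there the ratios to \<open>H (t, x0)\<close> stay in the right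
      half-plane, where \<open>Ln\<close> is continuous.\<close>
    ultimately obtain V N where V: "{0..1} \<subseteq> V" "openin X N" "x0 \<in> N" "V \<times> N \<subseteq> ?W"
      using tube_lemma_left[of "top_of_set {0..1::real}" X ?W "{0..1}" x0] x0 by blast
    have pos: "Re (H (t, x) / H (t, x0)) > 0" if "t \<in> {0..1}" "x \<in> N" for t x
    proof -
      have "(t, x) \<in> ?W"
        using V that by blast
      then show ?thesis
        by simp
    qed
    have NX: "N \<subseteq> topspace X"
      using V(2) openin_subset by blast
    have "l x = l x0 + Ln (f x / f x0)" if x: "x \<in> N" for x
    proof -
      \<comment> \<open>\<open>D\<close> is continuous with \<open>exp (D t) = 1\<close>, so it is
        constant because its values are discrete. The equation \<open>D 0 = D 1\<close> is the
        claimed formula for \<open>l x\<close>.\<close>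
      define D where "D t = L x t - L x0 t - Ln (H (t, x) / H (t, x0))" for t
      have xX: "x \<in> topspace X"
        using x NX by auto
      have nz: "H (t, x) \<noteq> 0" "H (t, x0) \<noteq> 0" if "t \<in> {0..1}" for t
        using normH that x0 xX by fastforce+
      have contD: "continuous_on {0..1} D"
        unfolding D_def
        by (intro continuous_intros contL x0 xX path)
           (use pos x nz in \<open>force simp: complex_nonpos_Reals_iff\<close>)+
      have expD: "exp (D t) = 1" if "t \<in> {0..1}" for t
        unfolding D_def exp_diff using nz[OF that] L[OF x0 that] L[OF xX that] by simp
      have "D constant_on {0..1}"
      proof (rule continuous_discrete_range_constant[OF _ contD])
        show "\<exists>e>0. \<forall>y. y \<in> {0..1} \<and> D y \<noteq> D t \<longrightarrow> e \<le> norm (D y - D t)" if "t \<in> {0..1}" for t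
        proof (intro exI[of _ "2*pi"] conjI allI impI)
          fix y assume y: "y \<in> {0..1} \<and> D y \<noteq> D t"
          have "exp (D y) = exp (D t)"
            using expD y that by simp
          then have "\<not> \<bar>Im (D y) - Im (D t)\<bar> < 2*pi"
            using y exp_complex_eqI by blast
          then show "2*pi \<le> norm (D y - D t)"
            using abs_Im_le_cmod[of "D y - D t"] by simp
        qed auto
      qed auto
      then have "D 0 = D 1"
        unfolding constant_on_def by auto
      moreover have "c \<noteq> 0"
        using norm_c by auto
      ultimately show ?thesis
        by (auto simp: D_def l_def H0 H1 algebra_simps)
    qed
    moreover have "Re (f x / f x0) > 0" if "x \<in> N" for x
      using pos[of 0 x] that unfolding H0 by simp
    ultimately show ?thesis
      using V(2,3) by blast
  qed
  have contf: "continuous_map X euclidean f"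
    using hom homotopic_with_imp_continuous_maps continuous_map_into_fulltopology by blast
  have "continuous_map X euclidean l"
    unfolding continuous_map_eq_topcontinuous_at topcontinuous_at_def
  proof (intro ballI conjI allI impI)
    fix x0 V assume x0: "x0 \<in> topspace X" and V: "openin euclidean V \<and> l x0 \<in> V"
    obtain N where N: "openin X N" "x0 \<in> N"
      and pos: "\<And>x. x \<in> N \<Longrightarrow> Re (f x / f x0) > 0"
      and l: "\<And>x. x \<in> N \<Longrightarrow> l x = l x0 + Ln (f x / f x0)"
      using local[OF x0] by blast
    have NX: "N \<subseteq> topspace X"
      using N(1) openin_subset by blast
    have "continuous_map (subtopology X N) (top_of_set {z. Re z > 0}) (\<lambda>x. f x / f x0)"
      using exp_l[OF x0] pos NX
      by (auto simp: continuous_map_in_subtopology intro!: continuous_map_divide_field continuous_map_from_subtopology contf)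
    moreover have "continuous_map (top_of_set {z. Re z > 0}) euclidean (\<lambda>z. l x0 + Ln z)"
      by (auto intro!: continuous_intros simp: complex_nonpos_Reals_iff)
    ultimately have "continuous_map (subtopology X N) euclidean (\<lambda>x. l x0 + Ln (f x / f x0))"
      by (rule continuous_map_compose[unfolded o_def])
    then have "continuous_map (subtopology X N) euclidean l"
      by (rule continuous_map_eq) (auto simp: l)
    then have "openin (subtopology X N) {x \<in> topspace (subtopology X N). l x \<in> V}"
      using V openin_continuous_map_preimage by blast
    then have "openin X {x \<in> topspace (subtopology X N). l x \<in> V}"
      using N(1) openin_open_subtopology by blast
    then show "\<exists>U. openin X U \<and> x0 \<in> U \<and> (\<forall>y\<in>U. l y \<in> V)"
      using N x0 V by (intro exI[of _ "{x \<in> topspace (subtopology X N). l x \<in> V}"]) auto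
  qed auto
  then show ?thesis
    using that exp_l by blast
qed

lemma continuous_square_root_contractible:
  fixes f :: "'a \<Rightarrow> complex"
  assumes "contractible_space X" "continuous_map X (top_of_set (sphere 0 1)) f"
  obtains r where "continuous_map X euclidean r" "\<And>x. x \<in> topspace X \<Longrightarrow> (r x)\<^sup>2 = f x"
proof -
  obtain c where "homotopic_with (\<lambda>x. True) X (top_of_set (sphere 0 1)) f (\<lambda>x. c)"
    using nullhomotopic_from_contractible_space[OF assms(2,1)] by blast
  then obtain l where l: "continuous_map X euclidean l" "\<And>x. x \<in> topspace X \<Longrightarrow> f x = exp (l x)"
    using continuous_logarithm_nullhomotopic by blast
  show ?thesis
  proof
    have "continuous_map X euclidean ((\<lambda>z. exp (z/2)) \<circ> l)"
      by (rule continuous_map_compose[OF l(1)]) (auto intro!: continuous_intros)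
    then show "continuous_map X euclidean (\<lambda>x. exp (l x / 2))"
      by (simp add: o_def)
    show "(exp (l x / 2))\<^sup>2 = f x" if "x \<in> topspace X" for x
      using l(2)[OF that] exp_double[of "l x / 2"] by simp
  qed
qed

subsection \<open>Counting square roots on a good cover\<close>

text \<open>The left side counts pairs of a map and a choice of signs for its local roots, the right
  side counts sets of two-element subsets of \<open>\<U>\<close>. The pattern of agreements of the
  local roots is an injection between them.\<close>

lemma card_circle_maps_good_cover_bound:
  fixes F :: "'i \<Rightarrow> 'b \<Rightarrow> complex"
  assumes conn: "connected_space Y" and ne: "topspace Y \<noteq> {}"
    and fin: "finite \<U>" and good: "good_open_cover Y \<U>"
    and F: "\<And>a. a \<in> A \<Longrightarrow> continuous_map Y (top_of_set (sphere 0 1)) (F a)"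
    and no_root: "\<And>a b s. \<lbrakk>a \<in> A; b \<in> A; a \<noteq> b; continuous_map Y euclidean s;
                    \<And>y. y \<in> topspace Y \<Longrightarrow> (s y)\<^sup>2 = F a y / F b y\<rbrakk> \<Longrightarrow> False"
  shows "card A * 2 ^ (card \<U> - 1) \<le> 2 ^ (card \<U> choose 2)"
proof -
  have opU: "openin Y U" and neU: "U \<noteq> {}" and conU: "contractible_space (subtopology Y U)"
    if "U \<in> \<U>" for U
    using good that unfolding good_open_cover_def by auto
  have UY: "U \<subseteq> topspace Y" if "U \<in> \<U>" for U
    using opU[OF that] openin_subset by blast
  have cover: "\<Union>\<U> = topspace Y"
    using good unfolding good_open_cover_def by auto
  have connUV: "connected_space (subtopology Y (U \<inter> V))" if "U \<in> \<U>" "V \<in> \<U>" for U V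
  proof (cases "U \<inter> V = {}")
    case False
    have "finite \<F> \<and> \<F> \<noteq> {} \<and> \<F> \<subseteq> \<U> \<and> \<Inter>\<F> \<noteq> {} \<longrightarrow> contractible_space (subtopology Y (\<Inter>\<F>))" for \<F>
      using good unfolding good_open_cover_def by blast
    from this[of "{U, V}"] False that show ?thesis
      by (simp add: contractible_imp_connected_space)
  qed (simp add: connected_space_subtopology)
  have Fnz: "F a y \<noteq> 0" if "a \<in> A" "y \<in> topspace Y" for a y
    using F[OF that(1)] that(2) by (force simp: continuous_map_def Pi_iff)
  obtain U0 where U0: "U0 \<in> \<U>"
    using ne cover by blast
  have "\<exists>r. continuous_map (subtopology Y U) euclidean r \<and> (\<forall>y\<in>U. (r y)\<^sup>2 = F a y)"
    if "a \<in> A" "U \<in> \<U>" for a U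
    using continuous_square_root_contractible[OF conU[OF that(2)] continuous_map_from_subtopology[OF F[OF that(1)]]]
      UY[OF that(2)] by (metis topspace_subtopology_subset)
  then obtain g where contg: "\<And>a U. \<lbrakk>a \<in> A; U \<in> \<U>\<rbrakk> \<Longrightarrow> continuous_map (subtopology Y U) euclidean (g a U)"
    and g: "\<And>a U y. \<lbrakk>a \<in> A; U \<in> \<U>; y \<in> U\<rbrakk> \<Longrightarrow> (g a U y)\<^sup>2 = F a y"
    by metis
  \<comment> \<open>\<open>B\<close> is the set of members on which the chosen root is
    negated.\<close>
  define r where "r = (\<lambda>(a, B) U y. if U \<in> B then - g a U y else g a U y)"
  \<comment> \<open>Negating all roots at once leaves the pattern unchanged, so the sign on
    \<open>U0\<close> is fixed. This is why the exponent is \<open>card \<U> - 1\<close>.\<close>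
  define D where "D = A \<times> Pow (\<U> - {U0})"
  have contr: "continuous_map (subtopology Y U) euclidean (r p U)" if "p \<in> D" "U \<in> \<U>" for p U
    using contg[of "fst p" U] that by (cases "U \<in> snd p") (auto simp: r_def D_def case_prod_unfold continuous_map_minus)
  have r2: "(r p U y)\<^sup>2 = F (fst p) y" if "p \<in> D" "U \<in> \<U>" "y \<in> U" for p U y
    using g[of "fst p" U y] that by (auto simp: r_def D_def case_prod_unfold)
  have rnz: "r p U y \<noteq> 0" if "p \<in> D" "U \<in> \<U>" "y \<in> U" for p U y
    using r2[OF that] Fnz[of "fst p" y] UY[OF that(2)] that by (auto simp: D_def)
  \<comment> \<open>One point of agreement suffices: intersections are connected, so the ratio of
    two roots is a constant sign there. Disjoint pairs never occur in the pattern.\<close>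
  define \<Phi> where "\<Phi> p = {P. \<exists>U\<in>\<U>. \<exists>V\<in>\<U>. P = {U, V} \<and> U \<noteq> V \<and> (\<exists>y\<in>U \<inter> V. r p U y = r p V y)}" for p
  have const: "r p U x / r p V x = r p U y / r p V y"
    if "p \<in> D" "U \<in> \<U>" "V \<in> \<U>" "x \<in> U \<inter> V" "y \<in> U \<inter> V" for p U V x y
  proof (rule continuous_map_sign_constant[OF connUV[OF that(2,3)]])
    show "continuous_map (subtopology Y (U \<inter> V)) euclidean (\<lambda>y. r p U y / r p V y)"
      using rnz that contr[OF that(1,2)] contr[OF that(1,3)]
      by (intro continuous_map_divide_field) (auto intro: continuous_map_from_subtopology_mono)
    show "(r p U z / r p V z)\<^sup>2 = 1" if z: "z \<in> topspace (subtopology Y (U \<inter> V))" for z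
      using r2[of p U z] r2[of p V z] Fnz[of "fst p" z] z \<open>p \<in> D\<close> \<open>U \<in> \<U>\<close> \<open>V \<in> \<U>\<close>
      by (auto simp: power_divide D_def)
  qed (use that UY in auto)
  \<comment> \<open>For equal patterns the local ratios glue to a global root \<open>R\<close> of
    the quotient of the two maps, so the maps coincide by \<open>no_root\<close>. Then
    \<open>R\<close> is a global sign, equal to 1 on \<open>U0\<close>, and the choices of signs
    coincide too.\<close>
  have inj: "inj_on \<Phi> D"
  proof (rule inj_onI)
    fix p p' assume p: "p \<in> D" and p': "p' \<in> D" and eq: "\<Phi> p = \<Phi> p'"
    have agree_iff: "r q U y = r q V y \<longleftrightarrow> {U, V} \<in> \<Phi> q"
      if "q \<in> D" "U \<in> \<U>" "V \<in> \<U>" "y \<in> U \<inter> V" "U \<noteq> V" for q U V y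
    proof
      assume "{U, V} \<in> \<Phi> q"
      then obtain U' V' x where "{U, V} = {U', V'}" "x \<in> U' \<inter> V'" "r q U' x = r q V' x"
        unfolding \<Phi>_def by blast
      then have "x \<in> U \<inter> V" "r q U x = r q V x"
        by (auto simp: doubleton_eq_iff)
      then show "r q U y = r q V y"
        using const[of q U V x y] rnz[of q V x] rnz[of q V y] that by auto
    qed (use that in \<open>auto simp: \<Phi>_def\<close>)
    have opp: "r q U y = r q V y \<or> r q U y = - r q V y"
      if "q \<in> D" "U \<in> \<U>" "V \<in> \<U>" "y \<in> U \<inter> V" for q U V y
      using r2[of q U y] r2[of q V y] that by (metis IntD1 IntD2 power2_eq_iff)
    \<comment> \<open>Passing from \<open>U\<close> to \<open>V\<close> either preserves both roots
      or negates both.\<close>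
    have ratio: "r p U y / r p' U y = r p V y / r p' V y"
      if "U \<in> \<U>" "V \<in> \<U>" "y \<in> U \<inter> V" for U V y
    proof (cases "U = V")
      case False
      then have "r p U y = r p V y \<longleftrightarrow> r p' U y = r p' V y"
        using agree_iff[OF p that False] agree_iff[OF p' that False] eq by simp
      then show ?thesis
        using opp[OF p that] opp[OF p' that] by auto
    qed auto
    obtain R where contR: "continuous_map Y euclidean R"
      and R: "\<And>y U. \<lbrakk>U \<in> \<U>; y \<in> topspace Y \<inter> U\<rbrakk> \<Longrightarrow> R y = r p U y / r p' U y"
    proof (rule pasting_lemma_exists[where X=Y and I=\<U> and T="\<lambda>U. U" and Y=euclidean and f="\<lambda>U y. r p U y / r p' U y"])
      show "continuous_map (subtopology Y U) euclidean (\<lambda>y. r p U y / r p' U y)" if "U \<in> \<U>" for U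
        using rnz[OF p' that] contr[OF p that] contr[OF p' that]
        by (intro continuous_map_divide_field) auto
      show "r p U y / r p' U y = r p V y / r p' V y"
        if "U \<in> \<U>" "V \<in> \<U>" "y \<in> topspace Y \<inter> U \<inter> V" for U V y
        by (rule ratio) (use that in auto)
    next
      show "topspace Y \<subseteq> (\<Union>U\<in>\<U>. U)"
        using cover by simp
    qed (use opU that in blast)+
    have R2: "(R y)\<^sup>2 = F (fst p) y / F (fst p') y" if y: "y \<in> topspace Y" for y
    proof -
      obtain U where "U \<in> \<U>" "y \<in> U"
        using y unfolding cover[symmetric] by blast
      then show ?thesis
        using R[of U y] r2[OF p, of U y] r2[OF p', of U y] y by (simp add: power_divide)
    qed
    have fst_eq: "fst p = fst p'"
    proof (rule ccontr)
      assume "fst p \<noteq> fst p'"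
      with p p' show False
        by (intro no_root[of "fst p" "fst p'" R] contR R2) (auto simp: D_def)
    qed
    obtain y0 where y0: "y0 \<in> U0"
      using neU[OF U0] by auto
    have "r p U0 y0 = r p' U0 y0"
      using p p' fst_eq by (auto simp: r_def D_def)
    then have R0: "R y0 = 1"
      using R[OF U0, of y0] y0 UY[OF U0] rnz[OF p' U0 y0] by auto
    have R1: "R y = 1" if "y \<in> topspace Y" for y
    proof -
      have "R y = R y0"
        using conn contR
      proof (rule continuous_map_sign_constant)
        show "(R x)\<^sup>2 = 1" if "x \<in> topspace Y" for x
          using R2[OF that] fst_eq Fnz[of "fst p'" x] p' that by (auto simp: D_def)
      qed (use that y0 UY[OF U0] in auto)
      then show ?thesis
        using R0 by simp
    qed
    have "U \<in> snd p \<longleftrightarrow> U \<in> snd p'" if U: "U \<in> \<U>" for U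
    proof -
      obtain y where y: "y \<in> U"
        using neU[OF U] by auto
      have "r p U y = r p' U y"
        using R[OF U, of y] R1[of y] y UY[OF U] rnz[OF p' U y] by auto
      then show ?thesis
        using rnz[OF p' U y] fst_eq by (auto simp: r_def case_prod_unfold split: if_splits)
    qed
    then have "snd p = snd p'"
      using p p' unfolding D_def by auto
    with fst_eq show "p = p'"
      by (simp add: prod_eq_iff)
  qed
  have sub: "\<Phi> ` D \<subseteq> Pow {P. P \<subseteq> \<U> \<and> card P = 2}"
    unfolding \<Phi>_def by (auto simp: card_2_iff)
  have "card D \<le> card (Pow {P. P \<subseteq> \<U> \<and> card P = 2})"
    using inj sub fin by (intro card_inj_on_le[of \<Phi>]) auto
  also have "\<dots> = 2 ^ (card \<U> choose 2)"
    using fin by (simp add: card_Pow n_subsets)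
  also have "card D = card A * 2 ^ (card \<U> - 1)"
    using fin U0 by (simp add: D_def card_cartesian_product card_Pow)
  finally show ?thesis .
qed

section \<open>Connectedness under homotopy equivalence, and the circle map without a square
  root\<close>

lemma homotopy_equivalent_space_connected:
  assumes "X homotopy_equivalent_space Y" "connected_space X"
  shows "connected_space Y"
proof -
  obtain f g where f: "continuous_map X Y f" and g: "continuous_map Y X g"
    and fg: "homotopic_with (\<lambda>x. True) Y Y (f \<circ> g) id"
    using assms(1) unfolding homotopy_equivalent_space_def by auto
  obtain H where H: "continuous_map (prod_topology (top_of_set {0..1::real}) Y) Y H"
    and H0: "\<And>y. H (0, y) = f (g y)" and H1: "\<And>y. H (1, y) = y"
    using fg unfolding homotopic_with_def by auto
  define C where "C y = (\<lambda>t. H (t, y)) ` {0..1::real} \<union> f ` topspace X" for y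
  have conC: "connectedin Y (C y)" if y: "y \<in> topspace Y" for y
    unfolding C_def
  proof (rule connectedin_Un)
    have "continuous_map (top_of_set {0..1}) Y (H \<circ> (\<lambda>t. (t, y)))"
      by (rule continuous_map_compose[OF _ H]) (use y in \<open>auto simp: continuous_map_pairwise o_def\<close>)
    then show "connectedin Y ((\<lambda>t. H (t, y)) ` {0..1})"
      using connectedin_continuous_map_image[of "top_of_set {0..1}" Y "\<lambda>t. H (t, y)" "{0..1}"]
      by (simp add: o_def connectedin_subtopology)
    show "connectedin Y (f ` topspace X)"
      using assms(2) connectedin_continuous_map_image[OF f] by (simp add: connectedin_topspace)
    have "f (g y) \<in> (\<lambda>t. H (t, y)) ` {0..1}"
      using H0[of y] by (metis atLeastAtMost_iff imageI order_refl zero_le_one)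
    moreover have "g y \<in> topspace X"
      using g y by (auto simp: continuous_map_def)
    ultimately show "(\<lambda>t. H (t, y)) ` {0..1} \<inter> f ` topspace X \<noteq> {}"
      by blast
  qed
  show ?thesis
  proof (cases "topspace Y = {}")
    case False
    then obtain y0 where "y0 \<in> topspace Y" by blast
    then have "f (g y0) \<in> f ` topspace X"
      using g by (auto simp: continuous_map_def)
    then have "connectedin Y (\<Union>y\<in>topspace Y. C y)"
      by (intro connectedin_Union) (use conC in \<open>auto simp: C_def\<close>)
    moreover have "topspace Y \<subseteq> (\<Union>y\<in>topspace Y. C y)"
    proof
      fix y assume "y \<in> topspace Y"
      moreover have "y \<in> C y"
        unfolding C_def using H1[of y] by (metis UnI1 atLeastAtMost_iff imageI order_refl zero_le_one)
      ultimately show "y \<in> (\<Union>y\<in>topspace Y. C y)" by blast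
    qed
    ultimately show ?thesis
      using connectedin_subset_topspace connectedin_topspace by (metis subset_antisym)
  qed simp
qed

text \<open>In the angle \<open>t\<close>, the quotient of \<open>s (cis t)\<close> by the obvious
  root \<open>cis (t/2)\<close> is a constant sign on \<open>{0..2*pi}\<close>. Its values at the
  two ends are opposite, however, since \<open>cis pi = -1\<close>.\<close>

lemma no_continuous_square_root_circle:
  assumes "continuous_on (sphere 0 1) (s :: complex \<Rightarrow> complex)"
    and "\<And>z. z \<in> sphere 0 1 \<Longrightarrow> (s z)\<^sup>2 = z"
  shows False
proof -
  define d where "d t = s (cis t) / cis (t/2)" for t
  have contd: "continuous_map (top_of_set {0..2*pi}) euclidean d"
    unfolding d_def
    by (auto intro!: continuous_intros continuous_on_compose2[OF assms(1)] simp: cis_neq_zero)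
  have "d 0 = d (2*pi)"
  proof (rule continuous_map_sign_constant[OF _ contd])
    show "(d t)\<^sup>2 = 1" for t
      using assms(2)[of "cis t"] by (simp add: d_def power_divide Complex.DeMoivre[of "t/2" 2])
  qed (auto simp: connected_space_subtopology)
  moreover have "d (2*pi) = - s 1" "d 0 = s 1"
    by (simp_all add: d_def)
  moreover have "(s 1)\<^sup>2 = 1"
    using assms(2)[of 1] by simp
  ultimately show False
    by auto
qed

text \<open>The maps \<open>v\<close> and \<open>u z / z\<close> are nullhomotopic, hence have
  square roots obtained by halving logarithms. A root of \<open>u / v\<close> would thus give a root
  of the identity.\<close>

lemma not_square_ratio_of_homotopic_circle_maps:
  assumes u: "homotopic_with_canon (\<lambda>x. True) (sphere 0 1) (sphere 0 1) u (\<lambda>z::complex. z)"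
    and v: "homotopic_with_canon (\<lambda>x. True) (sphere 0 1) (sphere 0 1) v (\<lambda>z. 1)"
    and s: "continuous_on (sphere 0 1) s" and s2: "\<And>z. z \<in> sphere 0 1 \<Longrightarrow> (s z)\<^sup>2 = u z / v z"
  shows False
proof -
  obtain k where k: "continuous_on (sphere 0 1) k"
    "\<And>z. z \<in> sphere 0 1 \<Longrightarrow> v z = exp (\<i> * of_real (k z))"
    using v inessential_eq_continuous_logarithm_circle[of "sphere 0 1" v] by blast
  obtain c where "homotopic_with_canon (\<lambda>x. True) (sphere 0 1) (sphere 0 1) (\<lambda>z. u z / z) (\<lambda>z. c)"
    using u homotopic_circlemaps_divide[of "sphere 0 1" u "\<lambda>z. z"] by auto
  then obtain l where l: "continuous_on (sphere 0 1) l"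
    "\<And>z. z \<in> sphere 0 1 \<Longrightarrow> u z / z = exp (\<i> * of_real (l z))"
    using inessential_eq_continuous_logarithm_circle[of "sphere 0 1" "\<lambda>z. u z / z"] by blast
  \<comment> \<open>Squaring gives \<open>(u / v) * v / (u / z) = z\<close>.\<close>
  define w where "w z = s z * exp (\<i> * of_real (k z) / 2) / exp (\<i> * of_real (l z) / 2)" for z
  show False
  proof (rule no_continuous_square_root_circle[of w])
    show "continuous_on (sphere 0 1) w"
      unfolding w_def by (intro continuous_intros s k(1) l(1)) auto
    show "(w z)\<^sup>2 = z" if z: "z \<in> sphere 0 1" for z
    proof -
      have unz: "u z \<noteq> 0"
        using l(2)[OF z] by auto
      have "(w z)\<^sup>2 = u z / v z * exp (\<i> * of_real (k z)) / exp (\<i> * of_real (l z))"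
        unfolding w_def power_divide power_mult_distrib s2[OF z] exp_double[symmetric] by simp
      also have "\<dots> = u z / (u z / z)"
        unfolding k(2)[OF z, symmetric] l(2)[OF z, symmetric] using k(2)[OF z] by simp
      also have "\<dots> = z"
        using unz by simp
      finally show ?thesis .
    qed
  qed
qed

subsection \<open>The lower bound\<close>

lemma continuous_map_from_sum_topology:
  assumes "\<And>i. i \<in> I \<Longrightarrow> continuous_map (X i) Y (\<lambda>x. f (i, x))"
  shows "continuous_map (sum_topology X I) Y f"
  unfolding continuous_map_def openin_sum_topology
proof (intro conjI allI impI ballI)
  show "f \<in> topspace (sum_topology X I) \<rightarrow> topspace Y"
    using assms by (fastforce simp: continuous_map_def)
  fix U i assume U: "openin Y U" and i: "i \<in> I"
  have "openin (X i) {x \<in> topspace (X i). f (i, x) \<in> U}"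
    using assms[OF i] U by (rule openin_continuous_map_preimage)
  moreover have "{x. (i, x) \<in> {p \<in> topspace (sum_topology X I). f p \<in> U}} = {x \<in> topspace (X i). f (i, x) \<in> U}"
    using i by auto
  ultimately show "openin (X i) {x. (i, x) \<in> {p \<in> topspace (sum_topology X I). f p \<in> U}}"
    by simp
qed auto

lemma bouquet_of_circles_connected:
  assumes "bouquet_of_circles h X" "h \<ge> 1"
  shows "connected_space X" "topspace X \<noteq> {}"
proof -
  let ?S = "sum_topology (\<lambda>_. top_of_set (sphere 0 1 :: complex set)) {..<h}"
  obtain q where q: "quotient_map ?S X q"
    and qq: "\<And>i j z w. \<lbrakk>i < h; j < h; z \<in> sphere 0 1; w \<in> sphere 0 1\<rbrakk> \<Longrightarrow>
           q (i, z) = q (j, w) \<longleftrightarrow> (i, z) = (j, w) \<or> z = 1 \<and> w = 1"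
    using assms(1) unfolding bouquet_of_circles_def by blast
  have qX: "q ` ({..<h} \<times> sphere 0 1) = topspace X"
    using quotient_imp_surjective_map[OF q] by (simp add: o_def)
  define C where "C i = (\<lambda>z. q (i, z)) ` sphere 0 1" for i
  have conC: "connectedin X (C i)" if "i < h" for i
  proof -
    have "continuous_map (top_of_set (sphere 0 1)) X (q \<circ> (\<lambda>z. (i, z)))"
      using that by (intro continuous_map_compose[OF continuous_map_component_injection
            quotient_imp_continuous_map[OF q]]) auto
    moreover have "connectedin (top_of_set (sphere 0 1)) (sphere 0 1 :: complex set)"
      by (simp add: connectedin_subtopology connected_sphere)
    ultimately show ?thesis
      unfolding C_def using connectedin_continuous_map_image by (fastforce simp: o_def)
  qed
  have base: "q (0, 1) \<in> C i" if "i < h" for i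
    using qq[of 0 i 1 1] assms(2) that unfolding C_def by force
  have "connectedin X (\<Union>i<h. C i)"
    by (rule connectedin_Union) (use conC base in blast)+
  moreover have "(\<Union>i<h. C i) = topspace X"
    unfolding qX[symmetric] C_def by force
  ultimately show "connected_space X"
    by (simp add: connectedin_topspace)
  show "topspace X \<noteq> {}"
    using qX assms(2) by (force simp: lessThan_empty_iff)
qed

text \<open>The counting bound is applied to \<open>2 ^ h\<close> maps on \<open>Y\<close>, one for
  each set \<open>a\<close> of circles, and exponents of 2 are compared.\<close>

lemma good_open_cover_bouquet_bound:
  fixes X :: "'a topology" and Y :: "'b topology"
  assumes bouquet: "bouquet_of_circles h X" "h \<ge> 1" and heq: "X homotopy_equivalent_space Y"
    and fin: "finite \<U>" and good: "good_open_cover Y \<U>"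
  shows "h \<le> (card \<U> - 1) choose 2"
proof -
  let ?C = "top_of_set (sphere 0 1 :: complex set)"
  let ?S = "sum_topology (\<lambda>_. ?C) {..<h}"
  obtain q where q: "quotient_map ?S X q"
    and qq: "\<And>i j z w. \<lbrakk>i < h; j < h; z \<in> sphere 0 1; w \<in> sphere 0 1\<rbrakk> \<Longrightarrow>
           q (i, z) = q (j, w) \<longleftrightarrow> (i, z) = (j, w) \<or> z = 1 \<and> w = 1"
    using bouquet(1) unfolding bouquet_of_circles_def by blast
  obtain f g where f: "continuous_map X Y f" and g: "continuous_map Y X g"
    and gf: "homotopic_with (\<lambda>x. True) X X (g \<circ> f) id"
    using heq unfolding homotopy_equivalent_space_def by auto
  have connY: "connected_space Y"
    using homotopy_equivalent_space_connected[OF heq] bouquet_of_circles_connected(1)[OF bouquet] by blast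
  have neY: "topspace Y \<noteq> {}"
    using bouquet_of_circles_connected(2)[OF bouquet] f unfolding continuous_map_def by blast
  have \<kappa>: "continuous_map ?C X (\<lambda>z. q (i, z))" if "i < h" for i
  proof -
    have "continuous_map ?C X (q \<circ> (\<lambda>z. (i, z)))"
      using that by (intro continuous_map_compose[OF continuous_map_component_injection
            quotient_imp_continuous_map[OF q]]) auto
    then show ?thesis
      by (simp add: o_def)
  qed
  \<comment> \<open>The map descends to the wedge because both branches send the base point to
    1.\<close>
  have "\<exists>P. continuous_map X ?C P \<and>
            (\<forall>i<h. \<forall>z\<in>sphere 0 1. P (q (i, z)) = (if i \<in> a then z else 1))" for a :: "nat set"
  proof -
    have "continuous_map ?S ?C (\<lambda>(i, z). if i \<in> a then z else 1)"
      by (rule continuous_map_from_sum_topology) auto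
    then obtain P where "continuous_map X ?C P"
      "\<And>p. p \<in> topspace ?S \<Longrightarrow> P (q p) = (\<lambda>(i, z). if i \<in> a then z else 1) p"
      by (rule quotient_map_lift_exists[OF q]) (use qq in \<open>auto simp: lessThan_def\<close>)
    then show ?thesis
      by (intro exI[of _ P]) auto
  qed
  then obtain P where contP: "\<And>a. continuous_map X ?C (P a)"
    and P: "\<And>a i z. \<lbrakk>i < h; z \<in> sphere 0 1\<rbrakk> \<Longrightarrow> P a (q (i, z)) = (if i \<in> a then z else 1)"
    by metis
  define F where "F a = P a \<circ> g" for a
  have contF: "continuous_map Y ?C (F a)" for a
    unfolding F_def by (rule continuous_map_compose[OF g contP])
  \<comment> \<open>Since \<open>g \<circ> f\<close> is homotopic to the identity,
    \<open>F a\<close> pulled back to circle \<open>i\<close> has the homotopy class of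
    \<open>P a\<close> on that circle.\<close>
  have hom: "homotopic_with_canon (\<lambda>x. True) (sphere 0 1) (sphere 0 1)
               (\<lambda>z. F a (f (q (i, z)))) (\<lambda>z. if i \<in> a then z else 1)" if "i < h" for a i
  proof -
    have "homotopic_with (\<lambda>x. True) ?C X ((g \<circ> f) \<circ> (\<lambda>z. q (i, z))) (id \<circ> (\<lambda>z. q (i, z)))"
      by (rule homotopic_with_compose_continuous_map_right[OF gf \<kappa>[OF that]]) auto
    then have "homotopic_with (\<lambda>x. True) ?C ?C (P a \<circ> ((g \<circ> f) \<circ> (\<lambda>z. q (i, z)))) (P a \<circ> (id \<circ> (\<lambda>z. q (i, z))))"
      by (rule homotopic_with_compose_continuous_map_left[OF _ contP]) auto
    then show ?thesis
      by (rule homotopic_with_eq) (use P[OF that] in \<open>auto simp: F_def\<close>)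
  qed
  have no_root: False if i: "i < h" "i \<in> a" "i \<notin> b" and s: "continuous_map Y euclidean s"
    "\<And>y. y \<in> topspace Y \<Longrightarrow> (s y)\<^sup>2 = F a y / F b y" for a b i s
  proof (rule not_square_ratio_of_homotopic_circle_maps)
    show "homotopic_with_canon (\<lambda>x. True) (sphere 0 1) (sphere 0 1) (\<lambda>z. F a (f (q (i, z)))) (\<lambda>z. z)"
      using hom[OF i(1), of a] i by simp
    show "homotopic_with_canon (\<lambda>x. True) (sphere 0 1) (sphere 0 1) (\<lambda>z. F b (f (q (i, z)))) (\<lambda>z. 1)"
      using hom[OF i(1), of b] i by simp
    have fq: "continuous_map ?C Y (f \<circ> (\<lambda>z. q (i, z)))"
      by (rule continuous_map_compose[OF \<kappa>[OF i(1)] f])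
    then have "continuous_map ?C euclidean (s \<circ> (f \<circ> (\<lambda>z. q (i, z))))"
      using s(1) by (rule continuous_map_compose)
    then show "continuous_on (sphere 0 1) (\<lambda>z. s (f (q (i, z))))"
      by (simp add: o_def)
    show "(s (f (q (i, z))))\<^sup>2 = F a (f (q (i, z))) / F b (f (q (i, z)))" if "z \<in> sphere 0 1" for z
      using fq that by (intro s(2)) (auto simp: continuous_map_def)
  qed
  have Fnz: "F a y \<noteq> 0" if "y \<in> topspace Y" for a y
    using contF[of a] that by (force simp: continuous_map_def Pi_iff)
  have "card (Pow {..<h}) * 2 ^ (card \<U> - 1) \<le> 2 ^ (card \<U> choose 2)"
  proof (rule card_circle_maps_good_cover_bound[OF connY neY fin good contF])
    fix a b s
    assume ab: "a \<in> Pow {..<h}" "b \<in> Pow {..<h}" "a \<noteq> b" and s: "continuous_map Y euclidean s"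
      and s2: "\<And>y. y \<in> topspace Y \<Longrightarrow> (s y)\<^sup>2 = F a y / F b y"
    then obtain i where i: "i < h" "i \<in> a \<and> i \<notin> b \<or> i \<notin> a \<and> i \<in> b"
      by blast
    have snz: "s y \<noteq> 0" if "y \<in> topspace Y" for y
      using s2[OF that] Fnz[OF that] by auto
    show False
      using i(2)
    proof (elim disjE conjE)
      assume "i \<in> a" "i \<notin> b"
      then show False
        using no_root[OF i(1) _ _ s s2] by blast
    next
      assume ba: "i \<notin> a" "i \<in> b"
      \<comment> \<open>Inverting the root exchanges the roles of \<open>a\<close> and
        \<open>b\<close>.\<close>
      have "continuous_map Y euclidean (\<lambda>y. 1 / s y)"
        using snz s by (intro continuous_map_divide_field) auto
      moreover have "(1 / s y)\<^sup>2 = F b y / F a y" if "y \<in> topspace Y" for y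
        using s2[OF that] by (simp add: power_divide)
      ultimately show False
        using no_root[OF i(1) ba(2,1)] by blast
    qed
  qed
  then have "(2::nat) ^ (h + (card \<U> - 1)) \<le> 2 ^ (card \<U> choose 2)"
    by (simp add: card_Pow power_add)
  then have le: "h + (card \<U> - 1) \<le> card \<U> choose 2"
    by (simp add: power_increasing_iff)
  have "\<U> \<noteq> {}"
    using good neY unfolding good_open_cover_def by blast
  then obtain m where "card \<U> = Suc m"
    using fin by (metis card_0_eq not0_implies_Suc)
  \<comment> \<open>The summand \<open>m = card \<U> - 1\<close> cancels against the choices of
    signs.\<close>
  moreover have "Suc m choose 2 = m + (m choose 2)" for m
    by (simp add: numeral_2_eq_2)
  ultimately show ?thesis
    using le by simp
qed

subsection \<open>Quotient maps and homeomorphic copies\<close>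

text \<open>The map \<open>g\<close> identifies points only within \<open>A\<close>. As
  \<open>H\<close> is constant on \<open>A\<close> at time 1, its final stage descends to a map
  \<open>f\<close> from \<open>X\<close> to \<open>Y\<close>; as \<open>H\<close> keeps
  \<open>A\<close> inside itself, \<open>g \<circ> H\<close> descends to a homotopy on
  \<open>X\<close>. These make \<open>f\<close> a homotopy inverse of \<open>g\<close>.\<close>

lemma homotopy_equivalent_space_collapse:
  assumes q: "quotient_map Y X g"
    and fibre: "\<And>x y. \<lbrakk>x \<in> topspace Y; y \<in> topspace Y; g x = g y\<rbrakk> \<Longrightarrow> x = y \<or> x \<in> A \<and> y \<in> A"
    and collapse: "\<And>x y. \<lbrakk>x \<in> A; y \<in> A\<rbrakk> \<Longrightarrow> g x = g y"
    and H: "continuous_map (prod_topology (top_of_set {0..1::real}) Y) Y H"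
    and H0: "\<And>y. y \<in> topspace Y \<Longrightarrow> H (0, y) = y"
    and HA: "\<And>t y. \<lbrakk>t \<in> {0..1}; y \<in> A\<rbrakk> \<Longrightarrow> H (t, y) \<in> A"
    and H1: "\<And>x y. \<lbrakk>x \<in> A; y \<in> A\<rbrakk> \<Longrightarrow> H (1, x) = H (1, y)"
  shows "Y homotopy_equivalent_space X"
proof -
  let ?I = "top_of_set {0..1::real}"
  have contg: "continuous_map Y X g"
    using q quotient_imp_continuous_map by blast
  have "continuous_map Y Y (H \<circ> (\<lambda>y. (1, y)))"
    by (rule continuous_map_compose[OF _ H]) (auto simp: continuous_map_pairwise o_def)
  then have "continuous_map Y Y (\<lambda>y. H (1, y))"
    by (simp add: o_def)
  then obtain f where f: "continuous_map X Y f" and fg: "\<And>y. y \<in> topspace Y \<Longrightarrow> f (g y) = H (1, y)"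
    by (rule quotient_map_lift_exists[OF q]) (use fibre H1 in blast)+
  have "homotopic_with (\<lambda>x. True) Y Y id (f \<circ> g)"
    by (subst homotopic_with) (use H H0 fg in auto)
  then have 1: "homotopic_with (\<lambda>x. True) Y Y (f \<circ> g) id"
    by (rule homotopic_with_symD)
  have lc: "locally_compact_space ?I" "Hausdorff_space ?I"
    by (simp_all add: compact_imp_locally_compact_space compact_space_subtopology Hausdorff_space_subtopology)
  \<comment> \<open>The product of a quotient map with the identity of a locally compact Hausdorff
    space is again a quotient map; this gives joint continuity of the descended homotopy.\<close>
  have q2: "quotient_map (prod_topology ?I Y) (prod_topology ?I X) (\<lambda>(t, y). (t, g y))"
    using quotient_map_prod_right[OF lc(1) _ q] lc(2) by blast
  have gH: "continuous_map (prod_topology ?I Y) X (g \<circ> H)"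
    using H contg by (rule continuous_map_compose)
  obtain K where K: "continuous_map (prod_topology ?I X) X K"
    and Kg: "\<And>p. p \<in> topspace (prod_topology ?I Y) \<Longrightarrow> K ((\<lambda>(t, y). (t, g y)) p) = (g \<circ> H) p"
  proof (rule quotient_map_lift_exists[OF q2 gH])
    fix p p' assume p: "p \<in> topspace (prod_topology ?I Y)" and p': "p' \<in> topspace (prod_topology ?I Y)"
      and "(\<lambda>(t, y). (t, g y)) p = (\<lambda>(t, y). (t, g y)) p'"
    then obtain t y y' where t: "p = (t, y)" "p' = (t, y')" "g y = g y'"
      by (cases p; cases p') auto
    then have "y = y' \<or> y \<in> A \<and> y' \<in> A" "t \<in> {0..1}"
      using p p' fibre[of y y'] by auto
    then show "(g \<circ> H) p = (g \<circ> H) p'"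
      using collapse HA t by auto
  qed blast
  have K': "K (t, g y) = g (H (t, y))" if "t \<in> {0..1}" "y \<in> topspace Y" for t y
    using Kg[of "(t, y)"] that by simp
  have surj: "g ` topspace Y = topspace X"
    using q quotient_imp_surjective_map by blast
  have "homotopic_with (\<lambda>x. True) X X id (g \<circ> f)"
  proof (subst homotopic_with, simp, intro exI conjI ballI)
    fix x assume "x \<in> topspace X"
    then obtain y where y: "y \<in> topspace Y" "x = g y"
      using surj by blast
    then show "K (0, x) = id x" "K (1, x) = (g \<circ> f) x"
      using K'[of _ y] H0 fg by auto
  qed (use K in auto)
  then have 2: "homotopic_with (\<lambda>x. True) X X (g \<circ> f) id"
    by (rule homotopic_with_symD)
  show ?thesis
    unfolding homotopy_equivalent_space_def using contg f 1 2 by blast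
qed

section \<open>Transport of good covers to copies on another point type\<close>

lemma good_open_cover_homeomorphic_image:
  assumes hom: "homeomorphic_map Y Z j" and good: "good_open_cover Y \<U>"
  shows "good_open_cover Z ((`) j ` \<U>)"
proof -
  have inj: "inj_on j (topspace Y)" and surj: "j ` topspace Y = topspace Z"
    using hom homeomorphic_imp_injective_map homeomorphic_imp_surjective_map by blast+
  have sub: "U \<subseteq> topspace Y" if "U \<in> \<U>" for U
    using good that openin_subset unfolding good_open_cover_def by blast
  have contractible_image: "contractible_space (subtopology Z (j ` S))"
    if "S \<subseteq> topspace Y" "contractible_space (subtopology Y S)" for S
  proof -
    have "homeomorphic_map (subtopology Y S) (subtopology Z (j ` S)) j"
      using that surj by (intro homeomorphic_map_subtopologies[OF hom]) auto
    then show ?thesis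
      using homeomorphic_space_contractibility homeomorphic_map_imp_homeomorphic_space that(2) by blast
  qed
  show ?thesis
    unfolding good_open_cover_def
  proof (intro conjI ballI allI impI)
    fix V assume "V \<in> (`) j ` \<U>"
    then obtain U where U: "U \<in> \<U>" "V = j ` U" by blast
    then have U': "openin Y U" "U \<noteq> {}" "contractible_space (subtopology Y U)"
      using good unfolding good_open_cover_def by auto
    show "openin Z V"
      using hom U U'(1) homeomorphic_map_openness_eq by blast
    show "V \<noteq> {}"
      using U U' by simp
    show "contractible_space (subtopology Z V)"
      using contractible_image[OF sub[OF U(1)] U'(3)] U by simp
  next
    show "\<Union> ((`) j ` \<U>) = topspace Z"
      using good surj unfolding good_open_cover_def by (metis image_Union)
  next
    fix \<F> assume F: "finite \<F> \<and> \<F> \<noteq> {} \<and> \<F> \<subseteq> (`) j ` \<U> \<and> \<Inter> \<F> \<noteq> {}"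
    then obtain \<G> where G: "\<G> \<subseteq> \<U>" "finite \<G>" "\<F> = (`) j ` \<G>"
      by (meson finite_subset_image)
    then have "\<G> \<noteq> {}"
      using F by auto
    then obtain G0 where G0: "G0 \<in> \<G>" by blast
    have "\<forall>U\<in>\<G>. U \<subseteq> topspace Y"
      using G(1) sub by blast
    \<comment> \<open>Injectivity of \<open>j\<close> on the space makes images commute with
      intersections.\<close>
    from image_INT[OF inj this G0] have eq: "\<Inter> \<F> = j ` (\<Inter>\<G>)"
      unfolding G(3) by simp
    then have "contractible_space (subtopology Y (\<Inter>\<G>))"
      using good F G \<open>\<G> \<noteq> {}\<close> unfolding good_open_cover_def by auto
    moreover have "\<Inter>\<G> \<subseteq> topspace Y"
      using G(1) sub \<open>\<G> \<noteq> {}\<close> by blast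
    ultimately show "contractible_space (subtopology Z (\<Inter> \<F>))"
      unfolding eq using contractible_image by blast
  qed
qed

text \<open>The topology on the image is pulled back along the inverse of \<open>j\<close>. In this
  way a space is moved to another point type.\<close>

lemma homeomorphic_copy_exists:
  assumes inj: "inj_on j (topspace Y)"
  obtains Z where "homeomorphic_map Y Z j"
proof
  let ?i = "inv_into (topspace Y) j"
  let ?Z = "pullback_topology (j ` topspace Y) ?i Y"
  have "homeomorphic_maps Y ?Z j ?i"
    unfolding homeomorphic_maps_def
  proof (intro conjI ballI)
    have "continuous_map Y Y (?i \<circ> j)"
      by (rule continuous_map_eq[OF continuous_map_id]) (use inj in auto)
    then show "continuous_map Y ?Z j"
      by (rule continuous_map_pullback') auto
    have "continuous_map ?Z Y (id \<circ> ?i)"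
      by (rule continuous_map_pullback) auto
    then show "continuous_map ?Z Y ?i"
      by simp
  qed (use inj in \<open>auto simp: topspace_pullback_topology f_inv_into_f\<close>)
  then show "homeomorphic_map Y ?Z j"
    using homeomorphic_map_maps by blast
qed

lemma quotient_map_sum_topology:
  assumes "\<And>i. i \<in> I \<Longrightarrow> quotient_map (X i) (Y i) (f i)"
  shows "quotient_map (sum_topology X I) (sum_topology Y I) (\<lambda>(i, x). (i, f i x))"
  unfolding quotient_map_def
proof (intro conjI allI impI)
  have surj: "f i ` topspace (X i) = topspace (Y i)" if "i \<in> I" for i
    using assms[OF that] quotient_imp_surjective_map by blast
  show "(\<lambda>(i, x). (i, f i x)) ` topspace (sum_topology X I) = topspace (sum_topology Y I)"
  proof
    show "topspace (sum_topology Y I) \<subseteq> (\<lambda>(i, x). (i, f i x)) ` topspace (sum_topology X I)"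
    proof
      fix p assume "p \<in> topspace (sum_topology Y I)"
      then obtain i y where "p = (i, y)" "i \<in> I" "y \<in> topspace (Y i)" by auto
      moreover then obtain x where "x \<in> topspace (X i)" "y = f i x"
        using surj by blast
      ultimately show "p \<in> (\<lambda>(i, x). (i, f i x)) ` topspace (sum_topology X I)"
        by (auto intro!: image_eqI[of _ _ "(i, x)"])
    qed
  qed (use surj in fastforce)
  fix U assume U: "U \<subseteq> topspace (sum_topology Y I)"
  have *: "openin (X i) {x \<in> topspace (X i). (i, f i x) \<in> U} \<longleftrightarrow> openin (Y i) {y. (i, y) \<in> U}"
    if "i \<in> I" for i
  proof -
    have sub: "{y. (i, y) \<in> U} \<subseteq> topspace (Y i)"
      using U by auto
    have "\<forall>V\<subseteq>topspace (Y i). openin (X i) {x \<in> topspace (X i). f i x \<in> V} \<longleftrightarrow> openin (Y i) V"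
      using assms[OF that] unfolding quotient_map_def by blast
    from this[rule_format, OF sub] show ?thesis
      by simp
  qed
  have **: "{x. (i, x) \<in> {p \<in> topspace (sum_topology X I). (case p of (i, x) \<Rightarrow> (i, f i x)) \<in> U}} =
        {x \<in> topspace (X i). (i, f i x) \<in> U}" if "i \<in> I" for i
    using that by auto
  show "openin (sum_topology X I) {p \<in> topspace (sum_topology X I). (case p of (i, x) \<Rightarrow> (i, f i x)) \<in> U} =
      openin (sum_topology Y I) U"
  proof -
    have "{p \<in> topspace (sum_topology X I). (case p of (i, x) \<Rightarrow> (i, f i x)) \<in> U} \<subseteq> Sigma I (topspace \<circ> X)"
      by auto
    then show ?thesis
      unfolding openin_sum_topology using U * ** by (simp del: mem_Collect_eq)
  qed
qed

text \<open>A continuous surjection from a compact space onto a Hausdorff space is a quotient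
  map.\<close>

lemma quotient_map_unit_interval_circle:
  "quotient_map (top_of_set {0..1}) (top_of_set (sphere 0 1)) (\<lambda>s. cis (2 * pi * s))"
proof (rule continuous_imp_quotient_map)
  show "continuous_map (top_of_set {0..1}) (top_of_set (sphere 0 1)) (\<lambda>s. cis (2 * pi * s))"
    by (auto intro!: continuous_intros)
  show "(\<lambda>s. cis (2 * pi * s)) ` topspace (top_of_set {0..1}) = topspace (top_of_set (sphere 0 1))"
  proof
    show "topspace (top_of_set (sphere 0 1)) \<subseteq> (\<lambda>s. cis (2 * pi * s)) ` topspace (top_of_set {0..1})"
    proof
      fix z :: complex assume z: "z \<in> topspace (top_of_set (sphere 0 1))"
      then have eq: "z = cis (2 * pi * (Arg2pi z / (2 * pi)))"
        using Arg2pi_eq[of z] by (simp add: cis_conv_exp)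
      have range: "Arg2pi z / (2 * pi) \<in> {0..1}"
        using Arg2pi_ge_0[of z] Arg2pi_lt_2pi[of z] by (auto simp: field_simps)
      from eq show "z \<in> (\<lambda>s. cis (2 * pi * s)) ` topspace (top_of_set {0..1})"
        by (rule image_eqI) (use range in simp)
    qed
  qed auto
qed (auto simp: compact_space_subtopology Hausdorff_space_subtopology)

subsection \<open>Open stars in geometric realizations of graphs\<close>

text \<open>Barycentric coordinates: a vertex is a unit vector, and \<open>s\<close> runs from the
  first end of the edge to the second.\<close>

definition edge_point :: "nat \<times> nat \<Rightarrow> real \<Rightarrow> nat \<Rightarrow> real" where
  "edge_point e s = (\<lambda>i. if i = fst e then 1 - s else if i = snd e then s else 0)"

definition graph_realization :: "(nat \<times> nat) set \<Rightarrow> (nat \<Rightarrow> real) set" where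
  "graph_realization E = (\<Union>e\<in>E. edge_point e ` {0..1})"

definition open_star :: "(nat \<times> nat) set \<Rightarrow> nat \<Rightarrow> (nat \<Rightarrow> real) set" where
  "open_star E a = {x \<in> graph_realization E. x a > 0}"

lemma continuous_on_edge_point [continuous_intros]:
  assumes "continuous_on S f"
  shows "continuous_on S (\<lambda>x. edge_point e (f x))"
proof (rule continuous_on_coordinatewise_then_product)
  show "continuous_on S (\<lambda>x. edge_point e (f x) i)" for i
    unfolding edge_point_def using assms
    by (cases "i = fst e"; cases "i = snd e") (auto intro!: continuous_intros)
qed

lemma edge_point_in_graph_realization:
  "\<lbrakk>e \<in> E; s \<in> {0..1}\<rbrakk> \<Longrightarrow> edge_point e s \<in> graph_realization E"
  unfolding graph_realization_def by blast

lemma compact_graph_realization: "finite E \<Longrightarrow> compact (graph_realization E)"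
  unfolding graph_realization_def
  by (auto intro!: compact_UN compact_continuous_image continuous_intros)

lemma graph_realization_Un:
  "graph_realization (E \<union> F) = graph_realization E \<union> graph_realization F"
  by (simp add: graph_realization_def)

lemma continuous_on_snd_component:
  "continuous_on S (\<lambda>p :: 'a::topological_space \<times> ('i \<Rightarrow> 'b::topological_space). snd p i)"
  by (rule continuous_on_product_then_coordinatewise) (rule continuous_on_snd[OF continuous_on_id])

text \<open>The straight-line homotopy contracts \<open>S\<close> to \<open>a\<close>. If
  \<open>S\<close> is nonempty, the assumption at \<open>t = 1\<close> puts \<open>a\<close> in
  \<open>S\<close>.\<close>

lemma contractible_space_star_shaped:
  fixes S :: "(nat \<Rightarrow> real) set"
  assumes star: "\<And>x t. \<lbrakk>x \<in> S; t \<in> {0..1}\<rbrakk> \<Longrightarrow> (\<lambda>i. (1 - t) * x i + t * a i) \<in> S"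
  shows "contractible_space (top_of_set S)"
  unfolding contractible_space_def
proof (rule exI[of _ a], subst homotopic_with, simp, intro exI conjI ballI)
  let ?H = "\<lambda>(t, x) i. (1 - t) * x i + t * a i :: real"
  have "continuous_on ({0..1} \<times> S) ?H"
    unfolding case_prod_unfold
    by (intro continuous_on_coordinatewise_then_product continuous_on_snd_component continuous_on_add
        continuous_on_mult continuous_on_diff continuous_on_const continuous_on_fst continuous_on_id)
  then show "continuous_map (prod_topology (top_of_set {0..1}) (top_of_set S)) (top_of_set S) ?H"
    using star by (auto simp: prod_topology_subtopology_eu)
qed auto

lemma edge_point_convex:
  "(\<lambda>i. (1 - t) * edge_point e r i + t * edge_point e s i) = edge_point e ((1 - t) * r + t * s)"
  by (auto simp: edge_point_def fun_eq_iff algebra_simps)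

lemma edge_segment_convex:
  assumes "x \<in> edge_point e ` {0..1}" "y \<in> edge_point e ` {0..1}" "t \<in> {0..1}"
  shows "(\<lambda>i. (1 - t) * x i + t * y i) \<in> edge_point e ` {0..1}"
proof -
  obtain r s where rs: "x = edge_point e r" "y = edge_point e s" "r \<in> {0..1}" "s \<in> {0..1}"
    using assms by blast
  have "(1 - t) * r + t * s \<in> {0..1}"
    using convexD[of "{0..1::real}" r s "1 - t" t] rs assms(3) by auto
  then show ?thesis
    unfolding rs edge_point_convex by blast
qed

text \<open>A single open star is star-shaped about its vertex. The stars of two distinct vertices
  meet at most inside the one edge joining them, so larger intersections are convex. The orientation
  \<open>fst e < snd e\<close> rules out loops and double edges.\<close>

lemma good_open_cover_open_stars:
  assumes lt: "\<And>e. e \<in> E \<Longrightarrow> fst e < snd e"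
  shows "good_open_cover (top_of_set (graph_realization E)) (open_star E ` (fst ` E \<union> snd ` E))"
proof -
  let ?V = "fst ` E \<union> snd ` E"
  define vertex :: "nat \<Rightarrow> nat \<Rightarrow> real" where "vertex a = (\<lambda>i. if i = a then 1 else 0)" for a
  have vertex_edge: "vertex (fst e) \<in> edge_point e ` {0..1}" "vertex (snd e) \<in> edge_point e ` {0..1}"
    if "e \<in> E" for e
  proof -
    have "vertex (fst e) = edge_point e 0" "vertex (snd e) = edge_point e 1"
      using lt[OF that] by (auto simp: vertex_def edge_point_def)
    then show "vertex (fst e) \<in> edge_point e ` {0..1}" "vertex (snd e) \<in> edge_point e ` {0..1}"
      by auto
  qed
  have support: "a = fst e \<or> a = snd e" if "x \<in> edge_point e ` {0..1}" "x a > 0" for a e x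
    using that by (auto simp: edge_point_def split: if_splits)
  have cell: "\<exists>e\<in>E. x \<in> edge_point e ` {0..1} \<and> (a = fst e \<or> a = snd e)" if "x \<in> open_star E a" for a x
    using that support unfolding open_star_def graph_realization_def by blast
  have vertex_in: "vertex a \<in> open_star E a" if "a \<in> ?V" for a
  proof -
    have "vertex a \<in> graph_realization E"
      using that vertex_edge unfolding graph_realization_def by blast
    then show ?thesis
      by (simp add: open_star_def vertex_def)
  qed
  have segment_star: "(\<lambda>i. (1 - t) * x i + t * y i) \<in> open_star E a"
    if "x \<in> open_star E a" "y \<in> open_star E a" "e \<in> E" "x \<in> edge_point e ` {0..1}" "y \<in> edge_point e ` {0..1}"
      "t \<in> {0..1}" for x y a e t
  proof -
    have "(1 - t) * x a + t * y a > 0"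
      using that convexD[of "{0<..}" "x a" "y a" "1 - t" t] by (auto simp: open_star_def)
    moreover have "(\<lambda>i. (1 - t) * x i + t * y i) \<in> graph_realization E"
      using edge_segment_convex[OF that(4,5,6)] that(3) unfolding graph_realization_def by blast
    ultimately show ?thesis
      by (simp add: open_star_def)
  qed
  have contractible_Inter: "contractible_space (top_of_set (\<Inter>a\<in>J. open_star E a))"
    if J: "J \<subseteq> ?V" "J \<noteq> {}" and ne: "(\<Inter>a\<in>J. open_star E a) \<noteq> {}" for J
  proof (cases "\<exists>a. J = {a}")
    case True
    then obtain a where a: "J = {a}" by blast
    have "(\<lambda>i. (1 - t) * x i + t * vertex a i) \<in> open_star E a"
      if x: "x \<in> open_star E a" and t: "t \<in> {0..1}" for x t
    proof -
      obtain e where e: "e \<in> E" "x \<in> edge_point e ` {0..1}" "a = fst e \<or> a = snd e"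
        using cell[OF x] by blast
      then have "vertex a \<in> edge_point e ` {0..1}"
        using vertex_edge[OF e(1)] by auto
      then show ?thesis
        using segment_star[OF x vertex_in e(1,2) _ t] a J by blast
    qed
    then have "contractible_space (top_of_set (open_star E a))"
      by (rule contractible_space_star_shaped)
    then show ?thesis
      unfolding a by simp
  next
    case False
    then obtain a b where ab: "a \<in> J" "b \<in> J" "a < b"
      using J(2) by (metis is_singletonI' is_singletonE nat_neq_iff)
    \<comment> \<open>Any point of the intersection can serve as centre, since the whole
      intersection lies in one edge.\<close>
    obtain p where p: "p \<in> (\<Inter>a\<in>J. open_star E a)"
      using ne by blast
    \<comment> \<open>Positive coordinates occur only at the ends of an edge containing the point,
      so that edge must be \<open>(a, b)\<close>.\<close>
    have only_cell: "(a, b) \<in> E \<and> x \<in> edge_point (a, b) ` {0..1}"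
      if x: "x \<in> open_star E a" "x \<in> open_star E b" for x
    proof -
      obtain e where e: "e \<in> E" "x \<in> edge_point e ` {0..1}" "a = fst e \<or> a = snd e"
        using cell[OF x(1)] by blast
      moreover have "b = fst e \<or> b = snd e"
        using support[OF e(2)] x(2) by (simp add: open_star_def)
      ultimately have "e = (a, b)"
        using ab(3) lt[OF e(1)] by (auto simp: prod_eq_iff)
      with e show ?thesis by simp
    qed
    have "(\<lambda>i. (1 - t) * x i + t * p i) \<in> (\<Inter>a\<in>J. open_star E a)"
      if x: "x \<in> (\<Inter>a\<in>J. open_star E a)" and t: "t \<in> {0..1}" for x t
    proof
      fix c assume c: "c \<in> J"
      have "x \<in> open_star E a" "x \<in> open_star E b" "p \<in> open_star E a" "p \<in> open_star E b"
        and "x \<in> open_star E c" "p \<in> open_star E c"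
        using x p c ab by auto
      then show "(\<lambda>i. (1 - t) * x i + t * p i) \<in> open_star E c"
        using segment_star[of x c p "(a, b)" t] only_cell t by simp
    qed
    then show ?thesis
      by (rule contractible_space_star_shaped)
  qed
  have sub: "open_star E a \<subseteq> graph_realization E" for a
    by (auto simp: open_star_def)
  show ?thesis
    unfolding good_open_cover_def
  proof (intro conjI ballI allI impI)
    fix U assume "U \<in> open_star E ` ?V"
    then obtain a where a: "a \<in> ?V" "U = open_star E a" by blast
    have "continuous_map (top_of_set (graph_realization E)) euclidean (\<lambda>x. x a)"
      using continuous_on_subset[OF continuous_on_product_coordinates] by auto
    from openin_continuous_map_preimage[OF this, of "{0<..}"]
    show "openin (top_of_set (graph_realization E)) U"
      by (simp add: a(2) open_star_def)
    show "U \<noteq> {}"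
      using vertex_in[OF a(1)] a by blast
    then show "contractible_space (subtopology (top_of_set (graph_realization E)) U)"
      using contractible_Inter[of "{a}"] a sub[of a]
      by (simp add: subtopology_subtopology Int_absorb1 del: contractible_space_top_of_set)
  next
    show "\<Union> (open_star E ` ?V) = topspace (top_of_set (graph_realization E))"
    proof
      show "topspace (top_of_set (graph_realization E)) \<subseteq> \<Union> (open_star E ` ?V)"
      proof
        fix x assume x: "x \<in> topspace (top_of_set (graph_realization E))"
        then obtain e s where e: "e \<in> E" "x = edge_point e s" "s \<in> {0..1}"
          unfolding graph_realization_def by auto
        have "x (fst e) > 0 \<or> x (snd e) > 0"
          using e lt[OF e(1)] by (auto simp: edge_point_def)
        then show "x \<in> \<Union> (open_star E ` ?V)"
          using x e by (auto simp: open_star_def)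
      qed
    qed (use sub in auto)
  next
    fix \<F> assume F: "finite \<F> \<and> \<F> \<noteq> {} \<and> \<F> \<subseteq> open_star E ` ?V \<and> \<Inter>\<F> \<noteq> {}"
    then obtain J where J: "J \<subseteq> ?V" "\<F> = open_star E ` J"
      by (meson subset_imageE)
    then have "J \<noteq> {}"
      using F by auto
    then have "\<Inter>\<F> \<subseteq> graph_realization E"
      using J sub by blast
    then show "contractible_space (subtopology (top_of_set (graph_realization E)) (\<Inter>\<F>))"
      using contractible_Inter[OF J(1) \<open>J \<noteq> {}\<close>] F
      unfolding J(2) by (simp add: subtopology_subtopology Int_absorb1 del: contractible_space_top_of_set)
  qed
qed

subsection \<open>Collapsing a star-shaped spanning tree\<close>

text \<open>An interior point has exactly two positive coordinates. Their positions recover the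
  edge, and the value at the second end recovers \<open>s\<close>.\<close>

lemma edge_point_eq_interior:
  assumes "edge_point e s = edge_point e' s'" "fst e < snd e" "fst e' < snd e'" "0 < s" "s < 1"
  shows "e = e' \<and> s = s'"
proof -
  have "edge_point e' s' (fst e) = 1 - s" "edge_point e' s' (snd e) = s"
    unfolding assms(1)[symmetric] using assms(2) by (auto simp: edge_point_def)
  then have "fst e \<in> {fst e', snd e'}" "snd e \<in> {fst e', snd e'}"
    using assms(4,5) by (auto simp: edge_point_def split: if_splits)
  then have "e = e'"
    using assms(2,3) by (auto simp: prod_eq_iff)
  moreover have "s = s'"
    using fun_cong[OF assms(1), of "snd e"] assms(2) \<open>e = e'\<close> by (auto simp: edge_point_def)
  ultimately show ?thesis by blast
qed

text \<open>
  The tree is the star with centre \<open>0\<close> and leaves \<open>1, \<dots>, m\<close>. The homotopy shrinks it to its centre while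
  stretching every other edge, linearly from length \<open>1\<close> to length \<open>3\<close>, so that its ends cover the two
  tree edges being shrunk; the function \<open>\<phi>\<close> is the resulting coordinate of an end point.
\<close>

lemma star_tree_collapse:
  fixes m :: nat and D :: "(nat \<times> nat) set"
  defines "T \<equiv> graph_realization ({0} \<times> {1..m})"
  defines "G \<equiv> graph_realization ({0} \<times> {1..m} \<union> D)"
  assumes D: "\<And>e. e \<in> D \<Longrightarrow> 1 \<le> fst e \<and> fst e < snd e \<and> snd e \<le> m"
  obtains H where "continuous_on ({0..1::real} \<times> G) H" "H ` ({0..1} \<times> G) \<subseteq> G"
    "\<And>x. x \<in> G \<Longrightarrow> H (0, x) = x" "\<And>t x. \<lbrakk>t \<in> {0..1}; x \<in> T\<rbrakk> \<Longrightarrow> H (t, x) \<in> T"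
    "\<And>x y. \<lbrakk>x \<in> T; y \<in> T\<rbrakk> \<Longrightarrow> H (1, x) = H (1, y)"
proof -
  define \<phi> :: "real \<Rightarrow> real \<Rightarrow> real" where "\<phi> t y = max 0 (1 - \<bar>1 + t - (1 + 2 * t) * y\<bar>)" for t y
  define HT where "HT = (\<lambda>(t :: real, x :: nat \<Rightarrow> real) i. (1 - t) * x i + t * (if i = 0 then 1 else 0))"
  \<comment> \<open>The coordinate at the centre \<open>0\<close> is whatever makes the coordinates
    at \<open>0, ..., m\<close> sum to 1.\<close>
  define HD where "HD = (\<lambda>(t :: real, x :: nat \<Rightarrow> real) i.
      if i = 0 then 1 - (\<Sum>j=1..m. \<phi> t (x j)) else \<phi> t (x i))"
  define H where "H p = (if snd p \<in> T then HT p else HD p)" for p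
  have "D \<subseteq> {..m} \<times> {..m}"
    using D by force
  then have finD: "finite D"
    by (rule finite_subset) simp
  define R where "R = graph_realization D"
  have GTR: "G = T \<union> R"
    unfolding G_def T_def R_def by (rule graph_realization_Un)
  have clo: "closed T" "closed R"
    unfolding T_def R_def using finD by (auto intro!: compact_imp_closed compact_graph_realization)
  have contHT: "continuous_on S HT" for S
    unfolding HT_def case_prod_unfold
    by (intro continuous_on_coordinatewise_then_product continuous_on_snd_component continuous_on_add
        continuous_on_mult continuous_on_diff continuous_on_const continuous_on_fst continuous_on_id)
  have contHD: "continuous_on S HD" for S
  proof (rule continuous_on_coordinatewise_then_product)
    fix i
    have *: "continuous_on S (\<lambda>p. \<phi> (fst p) (snd p j))" for j
      unfolding \<phi>_def by (intro continuous_on_snd_component continuous_on_add continuous_on_max continuous_on_rabs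
        continuous_on_mult continuous_on_diff continuous_on_const continuous_on_fst continuous_on_id)
    show "continuous_on S (\<lambda>p. HD p i)"
      unfolding HD_def case_prod_unfold by (cases "i = 0") (auto intro!: continuous_on_diff continuous_on_sum continuous_on_const *)
  qed
  have \<phi>0: "\<phi> t 0 = 0" if "t \<in> {0..1}" for t
    using that by (auto simp: \<phi>_def)
  \<comment> \<open>Only the two ends of \<open>e\<close> contribute, because \<open>\<phi>\<close>
    vanishes at coordinate 0.\<close>
  have sum2: "(\<Sum>j=1..m. \<phi> t (edge_point e s j)) = \<phi> t (1 - s) + \<phi> t s" if "e \<in> D" "t \<in> {0..1}" for t e s
  proof -
    have "\<phi> t (edge_point e s j) = (if j = fst e then \<phi> t (1 - s) else 0) + (if j = snd e then \<phi> t s else 0)" for j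
      using D[OF that(1)] \<phi>0[OF that(2)] by (auto simp: edge_point_def)
    then show ?thesis
      using D[OF that(1)] by (simp add: sum.distrib)
  qed
  \<comment> \<open>The tree meets the other edges only in leaves. Both formulas give a leaf
    \<open>c\<close> the coordinates \<open>1 - t\<close> at \<open>c\<close> and \<open>t\<close>
    at \<open>0\<close>.\<close>
  have agree: "HT (t, x) = HD (t, x)" if t: "t \<in> {0..1}" and x: "x \<in> T" "x \<in> R" for t x
  proof -
    obtain c r where c: "x = edge_point (0, c) r" "c \<in> {1..m}"
      using x(1) unfolding T_def graph_realization_def by auto
    obtain e s where e: "x = edge_point e s" "e \<in> D"
      using x(2) unfolding R_def graph_realization_def by auto
    have "x 0 = 0"
      using D[OF e(2)] e(1) by (auto simp: edge_point_def)
    then have xi: "x i = (if i = c then 1 else 0)" for i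
      using c by (auto simp: edge_point_def)
    have \<phi>1: "\<phi> t 1 = 1 - t"
      using t by (auto simp: \<phi>_def)
    have "\<phi> t (x j) = (if j = c then 1 - t else 0)" for j
      using xi \<phi>0[OF t] \<phi>1 by auto
    then show ?thesis
      using c(2) xi by (auto simp: HT_def HD_def fun_eq_iff)
  qed
  have HT_T: "HT (t, x) \<in> T" if t: "t \<in> {0..1}" and x: "x \<in> T" for t x
  proof -
    obtain c r where c: "x = edge_point (0, c) r" "c \<in> {1..m}" "r \<in> {0..1}"
      using x unfolding T_def graph_realization_def by auto
    have "HT (t, x) = edge_point (0, c) ((1 - t) * r)"
      using c by (auto simp: HT_def edge_point_def fun_eq_iff algebra_simps)
    moreover have "(1 - t) * r \<in> {0..1}"
      using t c(3) by (auto intro: mult_le_one)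
    ultimately show ?thesis
      using c(2) unfolding T_def by (auto intro!: edge_point_in_graph_realization)
  qed
  have HD_G: "HD (t, x) \<in> G" if t: "t \<in> {0..1}" and x: "x \<in> R" for t x
  proof -
    obtain e s where e: "x = edge_point e s" "e \<in> D" "s \<in> {0..1}"
      using x unfolding R_def graph_realization_def by auto
    define a b where "a = fst e" and "b = snd e"
    have ab: "1 \<le> a" "a < b" "b \<le> m" "e = (a, b)"
      using D[OF e(2)] by (auto simp: a_def b_def)
    \<comment> \<open>The position along the stretched edge, ranging over
      \<open>[-t, 1 + t]\<close>. For \<open>r \<le> 0\<close> the point lies on the tree edge to
      \<open>a\<close>, for \<open>0 \<le> r \<le> 1\<close> on the edge \<open>(a, b)\<close>, and
      for \<open>1 \<le> r\<close> on the tree edge to \<open>b\<close>.\<close>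
    define r where "r = (1 + 2 * t) * s - t"
    have r: "- t \<le> r" "r \<le> 1 + t"
    proof -
      have "0 \<le> (1 + 2 * t) * s" "(1 + 2 * t) * s \<le> (1 + 2 * t) * 1"
        using e(3) t by (auto intro!: mult_nonneg_nonneg mult_left_mono)
      then show "- t \<le> r" "r \<le> 1 + t"
        unfolding r_def by simp_all
    qed
    have \<phi>a: "\<phi> t (1 - s) = max 0 (1 - \<bar>r\<bar>)" and \<phi>b: "\<phi> t s = max 0 (1 - \<bar>1 - r\<bar>)"
      by (simp_all add: \<phi>_def r_def algebra_simps)
    have HDi: "HD (t, x) i = (if i = 0 then 1 - (\<phi> t (1 - s) + \<phi> t s) else
                if i = a then \<phi> t (1 - s) else if i = b then \<phi> t s else 0)" for i
      using ab \<phi>0[OF t] unfolding HD_def prod.case e(1) sum2[OF e(2) t] by (auto simp: edge_point_def)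
    consider "r \<le> 0" | "0 \<le> r" "r \<le> 1" | "1 \<le> r" by linarith
    then show ?thesis
    proof cases
      case 1
      then have "HD (t, x) = edge_point (0, a) (1 + r)"
        using ab r t by (auto simp: HDi \<phi>a \<phi>b edge_point_def fun_eq_iff)
      moreover have "1 + r \<in> {0..1}"
        using 1 r t by auto
      ultimately show ?thesis
        using ab unfolding G_def by (auto intro!: edge_point_in_graph_realization)
    next
      case 2
      then have "HD (t, x) = edge_point (a, b) r"
        using ab r t by (auto simp: HDi \<phi>a \<phi>b edge_point_def fun_eq_iff)
      then show ?thesis
        using ab 2 e(2) unfolding G_def by (auto intro!: edge_point_in_graph_realization)
    next
      case 3
      then have "HD (t, x) = edge_point (0, b) (2 - r)"
        using ab r t by (auto simp: HDi \<phi>a \<phi>b edge_point_def fun_eq_iff)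
      moreover have "2 - r \<in> {0..1}"
        using 3 r t by auto
      ultimately show ?thesis
        using ab unfolding G_def by (auto intro!: edge_point_in_graph_realization)
    qed
  qed
  show ?thesis
  proof
    have "continuous_on ({0..1} \<times> T \<union> {0..1} \<times> R) (\<lambda>p. if snd p \<in> T then HT p else HD p)"
      by (rule continuous_on_cases) (use clo contHT contHD agree in \<open>auto intro!: closed_Times\<close>)
    moreover have "{0..1} \<times> T \<union> {0..1} \<times> R = {0..1::real} \<times> G"
      unfolding GTR by blast
    ultimately show "continuous_on ({0..1} \<times> G) H"
      unfolding H_def by simp
    show "H ` ({0..1} \<times> G) \<subseteq> G"
    proof clarify
      fix t x assume "t \<in> {0..1::real}" "x \<in> G"
      then show "H (t, x) \<in> G"
        using HT_T[of t x] HD_G[of t x] by (cases "x \<in> T") (auto simp: H_def GTR)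
    qed
    show "H (t, x) \<in> T" if "t \<in> {0..1}" "x \<in> T" for t x
      using HT_T that unfolding H_def by auto
    show "H (1, x) = H (1, y)" if "x \<in> T" "y \<in> T" for x y
      using that by (simp add: H_def HT_def)
    show "H (0, x) = x" if x: "x \<in> G" for x
    proof (cases "x \<in> T")
      case True
      then show ?thesis
        by (simp add: H_def HT_def)
    next
      case False
      then obtain e s where e: "x = edge_point e s" "e \<in> D" "s \<in> {0..1}"
        using x unfolding GTR R_def graph_realization_def by auto
      have 0: "(0::real) \<in> {0..1}" by simp
      have "\<phi> 0 y = y" if "y \<in> {0..1}" for y
        using that by (auto simp: \<phi>_def)
      then have "HD (0, x) = x"
        unfolding HD_def prod.case e(1) sum2[OF e(2) 0] using e(3) D[OF e(2)]
        by (auto simp: edge_point_def fun_eq_iff)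
      then show ?thesis
        using False by (simp add: H_def)
    qed
  qed
qed

text \<open>The map \<open>g\<close> sends the tree to the base point and wraps the edge
  \<open>\<epsilon> k\<close> once around circle \<open>k\<close>. It is a quotient map that
  identifies points only within the tree, so the collapse along the homotopy \<open>H\<close>
  applies.\<close>

lemma graph_homotopy_equivalent_bouquet:
  fixes X :: "'a topology" and \<epsilon> :: "nat \<Rightarrow> nat \<times> nat"
  assumes bouquet: "bouquet_of_circles h X" "h \<ge> 1"
    and inj: "inj_on \<epsilon> {..<h}"
    and \<epsilon>: "\<And>k. k < h \<Longrightarrow> 1 \<le> fst (\<epsilon> k) \<and> fst (\<epsilon> k) < snd (\<epsilon> k) \<and> snd (\<epsilon> k) \<le> m"
  shows "top_of_set (graph_realization ({0} \<times> {1..m} \<union> \<epsilon> ` {..<h})) homotopy_equivalent_space X"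
proof -
  define T where "T = graph_realization ({0} \<times> {1..m})"
  define G where "G = graph_realization ({0} \<times> {1..m} \<union> \<epsilon> ` {..<h})"
  let ?C = "top_of_set (sphere 0 1 :: complex set)"
  let ?S = "sum_topology (\<lambda>_. ?C) {..<h}"
  let ?I = "sum_topology (\<lambda>_. top_of_set {0..1::real}) {..<h}"
  obtain q where q: "quotient_map ?S X q"
    and qq: "\<And>i j z w. \<lbrakk>i < h; j < h; z \<in> sphere 0 1; w \<in> sphere 0 1\<rbrakk> \<Longrightarrow>
           q (i, z) = q (j, w) \<longleftrightarrow> (i, z) = (j, w) \<or> z = 1 \<and> w = 1"
    using bouquet(1) unfolding bouquet_of_circles_def by blast
  have contq: "continuous_map ?S X q"
    using q quotient_imp_continuous_map by blast
  define edge where "edge k = edge_point (\<epsilon> k) ` {0..1}" for k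
  have G_eq: "G = T \<union> (\<Union>k<h. edge k)"
    unfolding G_def T_def graph_realization_Un by (simp add: graph_realization_def edge_def)
  have closed_T: "closed T"
    unfolding T_def by (auto intro!: compact_imp_closed compact_graph_realization)
  have closed_edge: "closed (edge k)" for k
    unfolding edge_def by (auto intro!: compact_imp_closed compact_continuous_image continuous_intros)
  have T_edge: "s = 0 \<or> s = 1" if x: "edge_point (\<epsilon> k) s \<in> T" and k: "k < h" for k s
  proof -
    obtain c r where c: "edge_point (\<epsilon> k) s = edge_point (0, c) r"
      using x unfolding T_def graph_realization_def by auto
    have 0: "edge_point (\<epsilon> k) s 0 = 0"
      using \<epsilon>[OF k] by (auto simp: edge_point_def)
    have "r = 1"
      using 0 unfolding c by (simp add: edge_point_def)
    then have "edge_point (\<epsilon> k) s (snd (\<epsilon> k)) \<in> {0, 1}"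
      unfolding c by (simp add: edge_point_def)
    then show ?thesis
      using \<epsilon>[OF k] by (auto simp: edge_point_def)
  qed
  have edge_T: "edge_point (\<epsilon> k) s \<in> T" if s: "s = 0 \<or> s = 1" and k: "k < h" for k s
  proof -
    have "edge_point (\<epsilon> k) s = edge_point (0, if s = 0 then fst (\<epsilon> k) else snd (\<epsilon> k)) 1"
      using \<epsilon>[OF k] s by (auto simp: edge_point_def fun_eq_iff)
    then show ?thesis
      using \<epsilon>[OF k] unfolding T_def by (auto intro!: edge_point_in_graph_realization)
  qed
  \<comment> \<open>On edge \<open>k\<close> the coordinate at \<open>snd (\<epsilon> k)\<close> is
    the edge parameter. The index \<open>h\<close> stands for the tree, here and in
    \<open>P\<close>.\<close>
  define f where "f k x = (if k < h then q (k, cis (2 * pi * x (snd (\<epsilon> k)))) else q (0, 1))"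
    for k and x :: "nat \<Rightarrow> real"
  have f_edge: "f k (edge_point (\<epsilon> k) s) = q (k, cis (2 * pi * s))" if "k < h" for k s
    using \<epsilon>[OF that] that by (simp add: f_def edge_point_def)
  have base: "q (k, 1) = q (0, 1)" if "k < h" for k
    using qq[of k 0 1 1] that bouquet(2) by simp
  have f_T: "f k x = q (0, 1)" if x: "x \<in> T" "x \<in> edge k" "k < h" for k x
  proof -
    obtain s where s: "x = edge_point (\<epsilon> k) s"
      using x(2) unfolding edge_def by blast
    then have "s = 0 \<or> s = 1"
      using T_edge x by blast
    then show ?thesis
      using f_edge[OF x(3)] base[OF x(3)] s by (auto simp: cis_2pi)
  qed
  have same_edge: "k = l" if x: "x \<in> edge k" "x \<in> edge l" "x \<notin> T" "k < h" "l < h" for x k l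
  proof -
    obtain s s' where s: "x = edge_point (\<epsilon> k) s" "s \<in> {0..1}" "x = edge_point (\<epsilon> l) s'"
      using x(1,2) unfolding edge_def by blast
    moreover have "s \<noteq> 0" "s \<noteq> 1"
      using edge_T x(3,4) s(1) by blast+
    ultimately have "\<epsilon> k = \<epsilon> l"
      using edge_point_eq_interior[of "\<epsilon> k" s "\<epsilon> l" s'] \<epsilon> x(4,5) by auto
    then show ?thesis
      using inj x(4,5) by (auto dest: inj_onD)
  qed
  define P where "P k = (if k < h then edge k else T)" for k
  obtain g where contg: "continuous_map (top_of_set G) X g"
    and g: "\<And>x k. \<lbrakk>k \<in> {..h}; x \<in> topspace (top_of_set G) \<inter> P k\<rbrakk> \<Longrightarrow> g x = f k x"
  proof (rule pasting_lemma_exists_closed[where X = "top_of_set G" and I = "{..h}" and T = P and Y = X and f = f])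
    show "topspace (top_of_set G) \<subseteq> \<Union> (P ` {..h})"
      unfolding P_def G_eq by auto
    show "closedin (top_of_set G) (P k)" if "k \<in> {..h}" for k
      using closed_T closed_edge that unfolding P_def G_eq by (auto intro!: closed_subset)
    show "continuous_map (subtopology (top_of_set G) (P k)) X (f k)" if "k \<in> {..h}" for k
    proof (cases "k < h")
      case True
      have "continuous_map (top_of_set G) ?C (\<lambda>x. cis (2 * pi * x (snd (\<epsilon> k))))"
        using continuous_on_subset[OF continuous_on_product_coordinates]
        by (auto intro!: continuous_on_cis continuous_on_mult continuous_on_const)
      then have "continuous_map (subtopology (top_of_set G) (P k)) ?C (\<lambda>x. cis (2 * pi * x (snd (\<epsilon> k))))"
        by (rule continuous_map_from_subtopology)
      moreover have "continuous_map ?C X (q \<circ> (\<lambda>z. (k, z)))"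
        using True by (intro continuous_map_compose[OF continuous_map_component_injection contq]) auto
      ultimately have "continuous_map (subtopology (top_of_set G) (P k)) X
          ((q \<circ> (\<lambda>z. (k, z))) \<circ> (\<lambda>x. cis (2 * pi * x (snd (\<epsilon> k)))))"
        by (rule continuous_map_compose)
      then show ?thesis
        using True by (simp add: f_def[abs_def] o_def)
    next
      case False
      have "(0, 1) \<in> topspace ?S"
        using bouquet(2) by simp
      then have "q (0, 1) \<in> topspace X"
        using quotient_imp_surjective_map[OF q] by blast
      then show ?thesis
        using False by (simp add: f_def[abs_def])
    qed
    show "f k x = f l x" if "k \<in> {..h}" "l \<in> {..h}" "x \<in> topspace (top_of_set G) \<inter> P k \<inter> P l" for k l x
    proof (cases "x \<in> T")
      case True
      have "f i x = q (0, 1)" if "x \<in> P i" for i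
        using f_T[OF True] that by (cases "i < h") (auto simp: P_def f_def)
      then show ?thesis
        using that by auto
    next
      case False
      then have "k < h" "l < h" "x \<in> edge k" "x \<in> edge l"
        using that by (auto simp: P_def split: if_splits)
      then show ?thesis
        using same_edge False by blast
    qed
  qed blast+
  have g_edge: "g (edge_point (\<epsilon> k) s) = q (k, cis (2 * pi * s))" if "k < h" "s \<in> {0..1}" for k s
  proof -
    have "edge_point (\<epsilon> k) s \<in> edge k"
      using that(2) unfolding edge_def by blast
    then have "edge_point (\<epsilon> k) s \<in> topspace (top_of_set G) \<inter> P k"
      using that(1) unfolding P_def G_eq by auto
    then show ?thesis
      using g[of k "edge_point (\<epsilon> k) s"] f_edge[of k s] that(1) by simp
  qed
  have g_T: "g x = q (0, 1)" if "x \<in> T" for x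
    using g[of h x] that unfolding P_def G_eq f_def by auto
  have G_cases: "\<exists>k<h. \<exists>s. 0 < s \<and> s < 1 \<and> x = edge_point (\<epsilon> k) s" if x: "x \<in> G" "x \<notin> T" for x
  proof -
    obtain k s where k: "k < h" "s \<in> {0..1}" "x = edge_point (\<epsilon> k) s"
      using x unfolding G_eq edge_def by auto
    moreover have "s \<noteq> 0" "s \<noteq> 1"
      using edge_T[of s k] k(1) x(2) unfolding k(3) by blast+
    ultimately show ?thesis
      by (intro exI[of _ k] conjI exI[of _ s]) auto
  qed
  have cis_inj: "s = s'" if "cis (2 * pi * s) = cis (2 * pi * s')" "0 \<le> s" "s < 1" "0 \<le> s'" "s' < 1" for s s'
  proof -
    have "\<i> * of_real (2 * pi * s) = \<i> * of_real (2 * pi * s')"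
    proof (rule exp_complex_eqI)
      have "\<bar>s - s'\<bar> < 1"
        using that by linarith
      then have "2 * pi * \<bar>s - s'\<bar> < 2 * pi"
        by simp
      also have "2 * pi * \<bar>s - s'\<bar> = \<bar>2 * pi * s - 2 * pi * s'\<bar>"
        by (simp add: abs_mult flip: right_diff_distrib)
      finally show "\<bar>Im (\<i> * of_real (2 * pi * s)) - Im (\<i> * of_real (2 * pi * s'))\<bar> < 2 * pi"
        by simp
    qed (use that(1) in \<open>simp add: cis_conv_exp\<close>)
    then show ?thesis
      by simp
  qed
  have fibre: "x = y \<or> x \<in> T \<and> y \<in> T" if hyp: "x \<in> G" "y \<in> G" "g x = g y" for x y
  proof -
    have mixed: "g x \<noteq> g y" if xy: "x \<in> T" "y \<in> G" "y \<notin> T" for x y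
    proof
      assume eq: "g x = g y"
      obtain k s where k: "k < h" "0 < s" "s < 1" "y = edge_point (\<epsilon> k) s"
        using G_cases xy(2,3) by blast
      then have "q (k, 1) = q (k, cis (2 * pi * s))"
        using g_edge[of k s] g_T[OF xy(1)] eq base[of k] by simp
      then have "cis (2 * pi * s) = cis (2 * pi * 0)"
        using qq[of k k 1 "cis (2 * pi * s)"] k(1) by simp
      then show False
        using cis_inj[of s 0] k by simp
    qed
    show ?thesis
    proof (cases "x \<in> T \<or> y \<in> T")
      case True
      then show ?thesis
        using mixed[of x y] mixed[of y x] hyp by metis
    next
      case False
      obtain k s where k: "k < h" "0 < s" "s < 1" "x = edge_point (\<epsilon> k) s"
        using G_cases hyp(1) False by blast
      obtain l r where l: "l < h" "0 < r" "r < 1" "y = edge_point (\<epsilon> l) r"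
        using G_cases hyp(2) False by blast
      have "q (k, cis (2 * pi * s)) = q (l, cis (2 * pi * r))"
        using g_edge[of k s] g_edge[of l r] k l hyp(3) by simp
      moreover have "cis (2 * pi * s) \<noteq> 1"
        using cis_inj[of s 0] k by auto
      ultimately have "k = l" "cis (2 * pi * s) = cis (2 * pi * r)"
        using qq[of k l "cis (2 * pi * s)" "cis (2 * pi * r)"] k(1) l(1) by auto
      then show ?thesis
        using cis_inj[of s r] k l by simp
    qed
  qed
  \<comment> \<open>Mapping a disjoint union of intervals onto the further edges and then applying
    \<open>g\<close> gives the quotient map through the circles. A continuous map through which a
    quotient map factors last is itself a quotient map.\<close>
  have quot_g: "quotient_map (top_of_set G) X g"
  proof (rule quotient_map_from_composition[OF _ contg])
    show "continuous_map ?I (top_of_set G) (\<lambda>(k, s). edge_point (\<epsilon> k) s)"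
    proof (rule continuous_map_from_sum_topology)
      show "continuous_map (top_of_set {0..1}) (top_of_set G) (\<lambda>s. case (k, s) of (k, s) \<Rightarrow> edge_point (\<epsilon> k) s)"
        if "k \<in> {..<h}" for k
        using that unfolding G_eq edge_def
        by (auto intro!: continuous_on_edge_point continuous_on_id)
    qed
    have "quotient_map ?I X (q \<circ> (\<lambda>(k, s). (k, cis (2 * pi * s))))"
      by (rule quotient_map_compose[OF _ q], rule quotient_map_sum_topology) (rule quotient_map_unit_interval_circle)
    then show "quotient_map ?I X (g \<circ> (\<lambda>(k, s). edge_point (\<epsilon> k) s))"
      by (rule quotient_map_eq) (use g_edge in auto)
  qed
  have D: "1 \<le> fst e \<and> fst e < snd e \<and> snd e \<le> m" if "e \<in> \<epsilon> ` {..<h}" for e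
    using \<epsilon> that by auto
  obtain H where H: "continuous_on ({0..1::real} \<times> G) H" "H ` ({0..1} \<times> G) \<subseteq> G"
    and H': "\<And>x. x \<in> G \<Longrightarrow> H (0, x) = x" "\<And>t x. \<lbrakk>t \<in> {0..1}; x \<in> T\<rbrakk> \<Longrightarrow> H (t, x) \<in> T"
    "\<And>x y. \<lbrakk>x \<in> T; y \<in> T\<rbrakk> \<Longrightarrow> H (1, x) = H (1, y)"
    by (rule star_tree_collapse[where m = m and D = "\<epsilon> ` {..<h}", OF D, folded G_def T_def]) (assumption | rule that)+
  have "top_of_set G homotopy_equivalent_space X"
  proof (rule homotopy_equivalent_space_collapse[OF quot_g, where A = T and H = H])
    show "continuous_map (prod_topology (top_of_set {0..1}) (top_of_set G)) (top_of_set G) H"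
      using H by (simp add: prod_topology_subtopology_eu image_subset_iff_funcset)
    show "g x = g y" if "x \<in> T" "y \<in> T" for x y
      using g_T that by simp
    show "H (0, x) = x" if "x \<in> topspace (top_of_set G)" for x
      using H'(1) that by simp
    show "x = y \<or> x \<in> T \<and> y \<in> T"
      if "x \<in> topspace (top_of_set G)" "y \<in> topspace (top_of_set G)" "g x = g y" for x y
      using fibre[of x y] that by simp
  qed (fact H'(2,3))+
  then show ?thesis
    unfolding G_def .
qed

subsection \<open>Covering types\<close>

lemma gbinomial_two: "((x :: real) gchoose 2) = x * (x - 1) / 2"
  by (simp add: gbinomial_prod_rev numeral_2_eq_2)

lemma choose_two_real: "real (n choose 2) = real n * (real n - 1) / 2"
  by (simp add: binomial_gbinomial gbinomial_two)

section \<open>Cardinalities: room for the graph in the point type of the bouquet\<close>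

lemma reals_lepoll_bouquet:
  assumes "bouquet_of_circles h X" "h \<ge> 1"
  shows "(UNIV :: real set) \<lesssim> topspace X"
proof -
  obtain q where q: "quotient_map (sum_topology (\<lambda>_. top_of_set (sphere 0 1 :: complex set)) {..<h}) X q"
    and qq: "\<And>i j z w. \<lbrakk>i < h; j < h; z \<in> sphere 0 1; w \<in> sphere 0 1\<rbrakk> \<Longrightarrow>
           q (i, z) = q (j, w) \<longleftrightarrow> (i, z) = (j, w) \<or> z = 1 \<and> w = 1"
    using assms(1) unfolding bouquet_of_circles_def by blast
  have "inj_on cis {0..<1}"
  proof (rule inj_onI)
    fix s t :: real assume "s \<in> {0..<1}" "t \<in> {0..<1}" "cis s = cis t"
    moreover from this have "\<bar>s - t\<bar> < 2 * pi"
      using pi_gt3 by auto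
    ultimately show "s = t"
      using exp_complex_eqI[of "\<i> * of_real s" "\<i> * of_real t"] by (simp add: cis_conv_exp)
  qed
  then have "inj_on (\<lambda>t. q (0, cis t)) {0..<1}"
    using qq[of 0 0] assms(2) by (auto simp: inj_on_def)
  moreover have "(\<lambda>t. q (0, cis t)) ` {0..<1} \<subseteq> topspace X"
    using quotient_imp_surjective_map[OF q] assms(2) by auto
  ultimately have "{0..<1::real} \<lesssim> topspace X"
    unfolding lepoll_def by blast
  then show ?thesis
    using reals_lepoll_reals01 lepoll_trans by blast
qed

lemma graph_realization_lepoll_reals: "graph_realization E \<lesssim> (UNIV :: real set)"
proof -
  \<comment> \<open>Distinct edges receive disjoint intervals \<open>[2 k, 2 k + 1]\<close>; with
    spacing 1, neighbouring intervals would share an end point.\<close>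
  let ?code = "\<lambda>(e, s). 2 * real (prod_encode e) + s"
  have "graph_realization E \<subseteq> (\<lambda>(e, s). edge_point e s) ` (E \<times> {0..1})"
    unfolding graph_realization_def by auto
  then have "graph_realization E \<lesssim> E \<times> {0..1::real}"
    by (rule subset_image_lepoll)
  also have "inj_on ?code (E \<times> {0..1})"
  proof (rule inj_onI)
    fix p p' assume p: "p \<in> E \<times> {0..1}" "p' \<in> E \<times> {0..1}" and eq: "?code p = ?code p'"
    have "\<not> prod_encode (fst p) < prod_encode (fst p')" "\<not> prod_encode (fst p') < prod_encode (fst p)"
      using p eq by (auto simp: Suc_le_eq[symmetric] dest!: of_nat_mono[where 'a = real])
    then have "prod_encode (fst p) = prod_encode (fst p')"
      by linarith
    then show "p = p'"
      using eq by (cases p; cases p') (simp add: prod_encode_eq)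
  qed
  then have "E \<times> {0..1::real} \<lesssim> (UNIV :: real set)"
    unfolding lepoll_def by blast
  finally show ?thesis .
qed

text \<open>The \<open>m\<close> leaves offer \<open>m choose 2\<close> places for the
  \<open>h\<close> further edges, and the \<open>m + 1\<close> vertices give at most
  \<open>m + 1\<close> open stars. The graph consists of functions
  \<open>nat \<Rightarrow> real\<close>, so a homeomorphic copy on \<open>'a + 'u\<close> has to be
  made.\<close>

lemma bouquet_covering_type_upper:
  fixes X :: "'a topology"
  assumes bouquet: "bouquet_of_circles h X" "h \<ge> 1" and h: "h \<le> m choose 2"
  shows "covering_type TYPE('a + 'u) X \<le> enat (Suc m)"
proof -
  let ?D = "{(a, b). 1 \<le> a \<and> a < b \<and> b \<le> m}"
  have "{P. P \<subseteq> {1..m} \<and> card P = 2} \<subseteq> (\<lambda>(a, b). {a, b}) ` ?D"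
  proof clarify
    fix P assume P: "P \<subseteq> {1..m}" "card P = 2"
    then obtain a b where ab: "P = {a, b}" "a < b"
      by (metis card_2_iff insert_commute nat_neq_iff)
    then show "P \<in> (\<lambda>(a, b). {a, b}) ` ?D"
      using P by (intro image_eqI[of _ _ "(a, b)"]) auto
  qed
  moreover have finD: "finite ?D"
    by (rule finite_subset[of _ "{..m} \<times> {..m}"]) auto
  ultimately have "card {P. P \<subseteq> {1..m} \<and> card P = 2} \<le> card ?D"
    by (meson card_image_le card_mono finite_imageI order_trans)
  then have "card {..<h} \<le> card ?D"
    using h by (simp add: n_subsets)
  then obtain \<epsilon> where \<epsilon>: "inj_on \<epsilon> {..<h}" "\<epsilon> ` {..<h} \<subseteq> ?D"
    using card_le_inj[of "{..<h}" ?D] finD by auto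
  define E where "E = {0} \<times> {1..m} \<union> \<epsilon> ` {..<h}"
  let ?Y = "top_of_set (graph_realization E)"
  have \<epsilon>': "1 \<le> fst (\<epsilon> k) \<and> fst (\<epsilon> k) < snd (\<epsilon> k) \<and> snd (\<epsilon> k) \<le> m" if "k < h" for k
    using \<epsilon>(2) that by (cases "\<epsilon> k") force
  have YX: "?Y homotopy_equivalent_space X"
    unfolding E_def by (rule graph_homotopy_equivalent_bouquet[OF bouquet \<epsilon>(1) \<epsilon>'])
  let ?\<U> = "open_star E ` (fst ` E \<union> snd ` E)"
  have good: "good_open_cover ?Y ?\<U>"
    by (rule good_open_cover_open_stars) (use \<epsilon>' in \<open>auto simp: E_def\<close>)
  have V: "fst ` E \<union> snd ` E \<subseteq> {..m}"
    using \<epsilon>' by (force simp: E_def)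
  then have fin: "finite ?\<U>"
    using finite_subset by blast
  have "card ?\<U> \<le> card (fst ` E \<union> snd ` E)"
    using V finite_subset by (intro card_image_le) blast
  also have "\<dots> \<le> card {..m}"
    using V by (intro card_mono) auto
  finally have card: "card ?\<U> \<le> Suc m"
    by simp
  \<comment> \<open>The graph has at most as many points as the real line and the bouquet at least
    as many, so the graph injects into \<open>'a\<close>.\<close>
  have "graph_realization E \<lesssim> topspace X"
    by (rule lepoll_trans[OF graph_realization_lepoll_reals reals_lepoll_bouquet[OF bouquet]])
  then obtain i :: "(nat \<Rightarrow> real) \<Rightarrow> 'a" where "inj_on i (graph_realization E)"
    unfolding lepoll_def by blast
  define j where "j = (Inl :: 'a \<Rightarrow> 'a + 'u) \<circ> i"
  have "inj_on j (topspace ?Y)"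
    using \<open>inj_on i (graph_realization E)\<close> by (simp add: j_def inj_on_def)
  then obtain Z :: "('a + 'u) topology" where Z: "homeomorphic_map ?Y Z j"
    by (rule homeomorphic_copy_exists)
  have YZ: "?Y homotopy_equivalent_space Z"
    using Z homeomorphic_imp_homotopy_equivalent_space homeomorphic_map_imp_homeomorphic_space by blast
  have "X homotopy_equivalent_space Z"
    using YX homotopy_eqv_trans[OF _ YZ] homotopy_equivalent_space_sym by metis
  then have "covering_type TYPE('a + 'u) X \<le> strict_covering_type Z"
    unfolding covering_type_def by (intro Inf_lower) blast
  also have "\<dots> \<le> enat (card ((`) j ` ?\<U>))"
    unfolding strict_covering_type_def
    using good_open_cover_homeomorphic_image[OF Z good] fin by (intro Inf_lower) blast
  also have "\<dots> \<le> enat (Suc m)"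
    using card_image_le[OF fin, of "(`) j"] card by simp
  finally show ?thesis .
qed

text \<open>The bound on the size of a good cover is valid over every point type \<open>'b\<close>.
  A space without a finite good cover contributes \<open>\<infinity>\<close>, the infimum of the
  empty set.\<close>

lemma bouquet_covering_type_lower:
  fixes X :: "'a topology"
  assumes bouquet: "bouquet_of_circles h X" "h \<ge> 1"
    and n: "\<And>k. h \<le> (k - 1) choose 2 \<Longrightarrow> n \<le> k"
  shows "enat n \<le> covering_type TYPE('b) X"
  unfolding covering_type_def strict_covering_type_def
proof (rule Inf_greatest, clarify, rule Inf_greatest, clarify)
  fix Y :: "'b topology" and \<U>
  assume "X homotopy_equivalent_space Y" "finite \<U>" "good_open_cover Y \<U>"
  then have "h \<le> (card \<U> - 1) choose 2"
    by (rule good_open_cover_bouquet_bound[OF bouquet])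
  then show "enat n \<le> enat (card \<U>)"
    using n by (simp del: One_nat_def)
qed

theorem proposition4p1:
  fixes X :: "'a topology" and h :: nat
  assumes "h \<ge> 1" and "bouquet_of_circles h X"
  shows "\<exists>n :: nat.
           covering_type TYPE('a + 'u) X = enat n \<and>
           int n = \<lceil>(3 + sqrt (1 + 8 * real h)) / 2\<rceil> \<and>
           (\<forall>m :: int.
              ((of_int m - 2 :: real) gchoose 2) < real h \<and>
              real h \<le> ((of_int m - 1 :: real) gchoose 2) \<longleftrightarrow> m = int n)"
proof -
  have "h \<le> (Suc h) choose 2"
    by (simp add: numeral_2_eq_2)
  \<comment> \<open>The covering type will be \<open>m + 1\<close>: the \<open>m\<close> leaves of
    the star and its centre.\<close>
  define m where "m = (LEAST m. h \<le> m choose 2)"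
  have hm: "h \<le> m choose 2"
    unfolding m_def using \<open>h \<le> (Suc h) choose 2\<close> by (rule LeastI)
  have least: "m \<le> k" if "h \<le> k choose 2" for k
    unfolding m_def using that by (rule Least_le)
  have m2: "2 \<le> m"
    using hm assms(1) binomial_eq_0[of m 2] by (cases "m < 2") auto
  have "\<not> h \<le> (m - 1) choose 2"
    using least[of "m - 1"] m2 by auto
  then have mh: "real ((m - 1) choose 2) < real h"
    by simp
  have le: "real h \<le> real m * (real m - 1) / 2"
    using hm by (simp flip: choose_two_real)
  have gt: "(real m - 1) * (real m - 2) / 2 < real h"
    using mh m2 unfolding choose_two_real by (simp add: of_nat_diff algebra_simps)
  have ct: "covering_type TYPE('a + 'u) X = enat (Suc m)"
  proof (rule antisym)
    show "covering_type TYPE('a + 'u) X \<le> enat (Suc m)"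
      using bouquet_covering_type_upper[OF assms(2,1) hm] .
    show "enat (Suc m) \<le> covering_type TYPE('a + 'u) X"
    proof (rule bouquet_covering_type_lower[OF assms(2,1)])
      show "Suc m \<le> k" if "h \<le> (k - 1) choose 2" for k
        using least[OF that] m2 by linarith
    qed
  qed
  have ceil: "int (Suc m) = \<lceil>(3 + sqrt (1 + 8 * real h)) / 2\<rceil>"
  \<comment> \<open>Completing the square turns \<open>h \<le> m (m - 1) / 2\<close> into
    \<open>1 + 8 h \<le> (2 m - 1)^2\<close>, and \<open>(m - 1) (m - 2) / 2 < h\<close> into
    \<open>(2 m - 3)^2 < 1 + 8 h\<close>.\<close>
  proof (rule ceiling_unique[symmetric])
    have "sqrt (1 + 8 * real h) \<le> 2 * real m - 1"
      using le m2 by (intro real_le_lsqrt) (auto simp: power2_eq_square algebra_simps)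
    then show "(3 + sqrt (1 + 8 * real h)) / 2 \<le> of_int (int (Suc m))"
      by simp
    have "2 * real m - 3 < sqrt (1 + 8 * real h)"
      using gt by (intro real_less_rsqrt) (auto simp: power2_eq_square algebra_simps)
    then show "of_int (int (Suc m)) - 1 < (3 + sqrt (1 + 8 * real h)) / 2"
      by simp
  qed
  have "((of_int i - 2 :: real) gchoose 2) < real h \<and> real h \<le> ((of_int i - 1 :: real) gchoose 2) \<longleftrightarrow> i = int (Suc m)"
    for i :: int
  proof
    assume "i = int (Suc m)"
    then show "((of_int i - 2 :: real) gchoose 2) < real h \<and> real h \<le> ((of_int i - 1 :: real) gchoose 2)"
      using le gt by (simp add: gbinomial_two algebra_simps)
  next
    assume i: "((of_int i - 2 :: real) gchoose 2) < real h \<and> real h \<le> ((of_int i - 1 :: real) gchoose 2)"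
    \<comment> \<open>The generalised binomials are also positive at negative arguments. Comparing
      the two bounds gives \<open>2 (i - 2) > 0\<close> and excludes such \<open>i\<close>.\<close>
    then have "(of_int i - 2) * (of_int i - 3 :: real) < (of_int i - 1) * (of_int i - 2)"
      by (simp add: gbinomial_two algebra_simps)
    then have "2 < i"
      by (simp add: algebra_simps)
    define k where "k = nat (i - 1)"
    have k: "i = int (Suc k)" "2 \<le> k"
      using \<open>2 < i\<close> by (auto simp: k_def)
    have "real h \<le> real (k choose 2)" "real ((k - 1) choose 2) < real h"
      using i k unfolding choose_two_real by (auto simp: gbinomial_two of_nat_diff algebra_simps)
    then have "h \<le> k choose 2" "(k - 1) choose 2 < h"
      by simp_all
    \<comment> \<open>If \<open>m \<le> k - 1\<close>, then
      \<open>h \<le> m choose 2 \<le> (k - 1) choose 2 < h\<close>, which is absurd; minimality of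
      \<open>m\<close> gives \<open>m \<le> k\<close>.\<close>
    moreover have "(m choose 2) \<le> (k - 1) choose 2" if "m \<le> k - 1"
      using that by (rule binomial_right_mono)
    ultimately have "m = k"
      using least[of k] hm by (cases "m \<le> k - 1") auto
    then show "i = int (Suc m)"
      using k by simp
  qed
  then show ?thesis
    using ct ceil by blast
qed

end
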